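(* There is an algorithm which, given a graph $G$ with $n$ vertices together with a nice tree decomposition of $G$ of width $w$ with $O(n)$ nodes, computes the exact number of perfect matchings of $G$ in time $O(3^w n)$. If the nice tree decomposition is a path decomposition (that is, it has no join nodes), the time is $O(w2^w n)$.
   Context: A tree decomposition of a graph $G=(V,E)$ is a pair $(T,X)$ where $T$ is a tree with node set $I$ and $X$ maps nodes of $T$ to subsets of $V$ such that (a) every $v\in V$ lies in some $X(i)$; (b) for every $uv\in E$ there is $i\in I$ with $\{u,v\}\subseteq X(i)$; (c) for every $v\in V$ the nodes $i$ with $v\in X(i)$ induce a connected subgraph of $T$. Its width is $\max_{i\in I}|X(i)|-1$. A nice tree decomposition is a rooted tree decomposition in which each node has at most two children and: every leaf $i$ has $X(i)=\emptyset$; if $i$ has exactly one child $j$, then $X(i)$ and $X(j)$ differ by exactly one vertex, with either $X(i)\supset X(j)$ (introduce node) or $X(i)\subset X(j)$ (forget node); if $i$ has two children $j,k$, then $X(i)=X(j)=X(k)$ (join node); and the root $r$ has $X(r)=\emptyset$. Time is measured with arithmetic operations on integers counted at unit cost. *)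

theory Defs
  imports Main
begin

section \<open>Graphs, perfect matchings and trees\<close>

definition simple_graph :: "'a set \<Rightarrow> 'a set set \<Rightarrow> bool" where
  "simple_graph V E \<longleftrightarrow> finite V \<and> (\<forall>e\<in>E. e \<subseteq> V \<and> card e = 2)"

definition perfect_matching :: "'a set \<Rightarrow> 'a set set \<Rightarrow> 'a set set \<Rightarrow> bool" where
  "perfect_matching V E M \<longleftrightarrow> M \<subseteq> E \<and> (\<forall>v\<in>V. \<exists>!e. e \<in> M \<and> v \<in> e)"

definition num_perfect_matchings :: "'a set \<Rightarrow> 'a set set \<Rightarrow> nat" where
  "num_perfect_matchings V E = card {M. perfect_matching V E M}"

definition induced_edges :: "'a set set \<Rightarrow> 'a set \<Rightarrow> 'a set set" where
  "induced_edges E U = {e \<in> E. e \<subseteq> U}"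

definition connected_graph :: "'a set \<Rightarrow> 'a set set \<Rightarrow> bool" where
  "connected_graph V E \<longleftrightarrow>
     V \<noteq> {} \<and> (\<forall>u\<in>V. \<forall>v\<in>V. (u, v) \<in> {(a, b). {a, b} \<in> E}\<^sup>*)"

definition is_path :: "'a set set \<Rightarrow> 'a list \<Rightarrow> bool" where
  "is_path E p \<longleftrightarrow> distinct p \<and> successively (\<lambda>u v. {u, v} \<in> E) p"

definition is_cycle :: "'a set set \<Rightarrow> 'a list \<Rightarrow> bool" where
  "is_cycle E p \<longleftrightarrow> is_path E p \<and> 3 \<le> length p \<and> {last p, hd p} \<in> E"

definition is_tree :: "'a set \<Rightarrow> 'a set set \<Rightarrow> bool" where
  "is_tree I F \<longleftrightarrow> simple_graph I F \<and> connected_graph I F \<and> (\<nexists>p. is_cycle F p)"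

text \<open>In the tree with edge set \<open>F\<close> rooted at \<open>r\<close>, the node \<open>j\<close> is a child of \<open>i\<close> iff the
  path from \<open>r\<close> to \<open>j\<close> ends with the edge from \<open>i\<close> to \<open>j\<close>.\<close>

definition children :: "'i set set \<Rightarrow> 'i \<Rightarrow> 'i \<Rightarrow> 'i set" where
  "children F r i = {j. \<exists>p. is_path F (p @ [i, j]) \<and> hd (p @ [i, j]) = r}"


section \<open>Nice tree decompositions\<close>

definition tree_decomposition ::
    "'a set \<Rightarrow> 'a set set \<Rightarrow> 'i set \<Rightarrow> 'i set set \<Rightarrow> ('i \<Rightarrow> 'a set) \<Rightarrow> bool" where
  "tree_decomposition V E I F X \<longleftrightarrow>
     is_tree I F \<and>
     (\<forall>i\<in>I. X i \<subseteq> V) \<and>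
     (\<forall>v\<in>V. \<exists>i\<in>I. v \<in> X i) \<and>
     (\<forall>e\<in>E. \<exists>i\<in>I. e \<subseteq> X i) \<and>
     (\<forall>v\<in>V. connected_graph {i \<in> I. v \<in> X i} (induced_edges F {i \<in> I. v \<in> X i}))"

text \<open>Integer-valued, since the width is \<open>-1\<close> if all bags are empty.\<close>

definition width :: "'i set \<Rightarrow> ('i \<Rightarrow> 'a set) \<Rightarrow> int" where
  "width I X = int (Max ((\<lambda>i. card (X i)) ` I)) - 1"

definition nice_tree_decomposition ::
    "'a set \<Rightarrow> 'a set set \<Rightarrow> 'i set \<Rightarrow> 'i set set \<Rightarrow> 'i \<Rightarrow> ('i \<Rightarrow> 'a set) \<Rightarrow> bool" where
  "nice_tree_decomposition V E I F r X \<longleftrightarrow>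
     tree_decomposition V E I F X \<and>
     r \<in> I \<and> X r = {} \<and>
     (\<forall>i\<in>I.
        card (children F r i) \<le> 2 \<and>
        (children F r i = {} \<longrightarrow> X i = {}) \<and>
        (\<forall>j. children F r i = {j} \<longrightarrow>
           (\<exists>v. v \<notin> X j \<and> X i = insert v (X j)) \<or>
           (\<exists>v. v \<notin> X i \<and> X j = insert v (X i))) \<and>
        (\<forall>j k. j \<noteq> k \<and> children F r i = {j, k} \<longrightarrow> X i = X j \<and> X i = X k))"

definition no_join_nodes :: "'i set \<Rightarrow> 'i set set \<Rightarrow> 'i \<Rightarrow> bool" where
  "no_join_nodes I F r \<longleftrightarrow> (\<forall>i\<in>I. card (children F r i) \<noteq> 2)"


section \<open>Random access machine programs with unit-cost integer arithmetic\<close>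

text \<open>The memory of a machine consists of unbounded integer arrays (a program mentions only
  finitely many of them); a scalar variable \<open>x\<close> is the cell \<open>x[0]\<close>.  Every constant, every memory
  access, every arithmetic or logical operation, every assignment and every branching decision
  costs one time unit, whatever the size of the integers.\<close>

type_synonym state = "string \<Rightarrow> int \<Rightarrow> int"

datatype aexp =
    Const int
  | Cell string aexp
  | Add aexp aexp
  | Sub aexp aexp
  | Mul aexp aexp
  | Div aexp aexp

datatype bexp =
    Less aexp aexp
  | Eq aexp aexp
  | Neg bexp
  | Conj bexp bexp

datatype com =
    Skip
  | Assign string aexp aexp
  | Seq com com
  | If bexp com com
  | While bexp com

fun aval :: "aexp \<Rightarrow> state \<Rightarrow> int" where
  "aval (Const m) s = m"
| "aval (Cell x a) s = s x (aval a s)"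
| "aval (Add a b) s = aval a s + aval b s"
| "aval (Sub a b) s = aval a s - aval b s"
| "aval (Mul a b) s = aval a s * aval b s"
| "aval (Div a b) s = aval a s div aval b s"

fun bval :: "bexp \<Rightarrow> state \<Rightarrow> bool" where
  "bval (Less a b) s \<longleftrightarrow> aval a s < aval b s"
| "bval (Eq a b) s \<longleftrightarrow> aval a s = aval b s"
| "bval (Neg b) s \<longleftrightarrow> \<not> bval b s"
| "bval (Conj b c) s \<longleftrightarrow> bval b s \<and> bval c s"

fun acost :: "aexp \<Rightarrow> nat" where
  "acost (Const m) = 1"
| "acost (Cell x a) = acost a + 1"
| "acost (Add a b) = acost a + acost b + 1"
| "acost (Sub a b) = acost a + acost b + 1"
| "acost (Mul a b) = acost a + acost b + 1"
| "acost (Div a b) = acost a + acost b + 1"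

fun bcost :: "bexp \<Rightarrow> nat" where
  "bcost (Less a b) = acost a + acost b + 1"
| "bcost (Eq a b) = acost a + acost b + 1"
| "bcost (Neg b) = bcost b + 1"
| "bcost (Conj b c) = bcost b + bcost c + 1"

text \<open>\<open>exec c s k t\<close>: started in state \<open>s\<close>, the program \<open>c\<close> halts in state \<open>t\<close> after time \<open>k\<close>.
  \<open>Assign x a b\<close> is the assignment \<open>x[a] := b\<close>.\<close>

inductive exec :: "com \<Rightarrow> state \<Rightarrow> nat \<Rightarrow> state \<Rightarrow> bool" where
  exec_Skip: "exec Skip s 1 s"
| exec_Assign:
    "exec (Assign x a b) s (acost a + acost b + 1) (s(x := (s x)(aval a s := aval b s)))"
| exec_Seq: "exec c s k t \<Longrightarrow> exec d t l u \<Longrightarrow> exec (Seq c d) s (k + l) u"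
| exec_IfTrue: "bval b s \<Longrightarrow> exec c s k t \<Longrightarrow> exec (If b c d) s (bcost b + 1 + k) t"
| exec_IfFalse: "\<not> bval b s \<Longrightarrow> exec d s k t \<Longrightarrow> exec (If b c d) s (bcost b + 1 + k) t"
| exec_WhileFalse: "\<not> bval b s \<Longrightarrow> exec (While b c) s (bcost b + 1) s"
| exec_WhileTrue:
    "bval b s \<Longrightarrow> exec c s k t \<Longrightarrow> exec (While b c) t l u \<Longrightarrow>
     exec (While b c) s (bcost b + 1 + k + l) u"

inductive_cases exec_SkipE: "exec Skip s k t"
inductive_cases exec_AssignE: "exec (Assign x a b) s k t"
inductive_cases exec_SeqE: "exec (Seq c d) s k t"
inductive_cases exec_IfE: "exec (If b c d) s k t"
inductive_cases exec_WhileE: "exec (While b c) s k t"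

lemma exec_deterministic:
  "exec c s k t \<Longrightarrow> exec c s k' t' \<Longrightarrow> k = k' \<and> t = t'"
proof (induction arbitrary: k' t' rule: exec.induct)
  case (exec_Seq c s k t d l u)
  show ?case by (rule exec_SeqE[OF exec_Seq.prems]) (metis exec_Seq.IH)
next
  case (exec_WhileTrue b s c k t l u)
  from exec_WhileTrue.prems exec_WhileTrue.hyps(1) obtain m v p where
    run: "exec c s m v" "exec (While b c) v p t'" and k': "k' = bcost b + 1 + m + p"
    by (auto elim: exec_WhileE)
  have "k = m \<and> t = v" using exec_WhileTrue.IH(1) run(1) .
  moreover from this have "l = p \<and> u = t'" using exec_WhileTrue.IH(2) run(2) by simp
  ultimately show ?case using k' by simp
next
  case (exec_IfTrue b s c k t d)
  from exec_IfTrue.prems exec_IfTrue.hyps(1) show ?case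
    by (auto elim!: exec_IfE dest: exec_IfTrue.IH)
next
  case (exec_IfFalse b s d k t c)
  from exec_IfFalse.prems exec_IfFalse.hyps(1) show ?case
    by (auto elim!: exec_IfE dest: exec_IfFalse.IH)
qed (auto elim: exec_SkipE exec_AssignE exec_WhileE)


section \<open>Input format\<close>

text \<open>The graph has vertices \<open>0, \<dots>, n - 1\<close> and is given by adjacency lists.  The decomposition has
  nodes \<open>0, \<dots>, N - 1\<close>, numbered in any order, and is given by its root and, for every node,
  the list of its children and the list of the vertices in its bag.  All lists may be in any
  order.\<close>

definition lists_represent :: "nat \<Rightarrow> (nat \<Rightarrow> nat set) \<Rightarrow> nat list list \<Rightarrow> bool" where
  "lists_represent m A xss \<longleftrightarrow>
     length xss = m \<and> (\<forall>i<m. distinct (xss ! i) \<and> set (xss ! i) = A i)"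

definition array_of :: "nat list \<Rightarrow> int \<Rightarrow> int" where
  "array_of xs k = (if 0 \<le> k \<and> k < int (length xs) then int (xs ! nat k) else 0)"

text \<open>A list of lists \<open>xss\<close> is stored as the array of all entries, one list after the other,
  together with an array of positions: list \<open>i\<close> occupies the cells from position
  \<open>offsets xss ! i\<close> up to, but excluding, position \<open>offsets xss ! (i + 1)\<close>.\<close>

definition offsets :: "nat list list \<Rightarrow> nat list" where
  "offsets xss = map (\<lambda>i. length (concat (take i xss))) [0..<length xss + 1]"

definition initial_state ::
    "nat list list \<Rightarrow> nat \<Rightarrow> nat list list \<Rightarrow> nat list list \<Rightarrow> state" where
  "initial_state adj r chs bags =
     (\<lambda>x k. 0)
       (''n'' := array_of [length adj],
        ''adj_start'' := array_of (offsets adj),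
        ''adj'' := array_of (concat adj),
        ''nodes'' := array_of [length bags],
        ''root'' := array_of [r],
        ''child_start'' := array_of (offsets chs),
        ''child'' := array_of (concat chs),
        ''bag_start'' := array_of (offsets bags),
        ''bag'' := array_of (concat bags))"

definition input_state ::
    "nat \<Rightarrow> nat set set \<Rightarrow> nat \<Rightarrow> nat set set \<Rightarrow> nat \<Rightarrow> (nat \<Rightarrow> nat set) \<Rightarrow> state \<Rightarrow> bool" where
  "input_state n E N F r X s \<longleftrightarrow>
     (\<exists>adj chs bags.
        lists_represent n (\<lambda>v. {u. {v, u} \<in> E}) adj \<and>
        lists_represent N (children F r) chs \<and>
        lists_represent N X bags \<and>
        s = initial_state adj r chs bags)"

definition result :: "state \<Rightarrow> int" where
  "result s = s ''result'' 0"

end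

(* For a node i let F_i be the set of vertices that occur in the bags below i but not in X(i), and
   for S \<subseteq> X(i) let f_i(S) be the number of matchings with union F_i \<union> S all of whose edges meet F_i.
   An edge is thus counted where its first endpoint is forgotten.  A leaf has f_i({}) = 1, an
   introduce node has f_i(S) = f_j(S) (which is 0 if S contains the new vertex), a node forgetting v
   has f_i(S) = f_j(S + v) + sum of f_j(S - u) over the neighbours u of v in S, a join node has
   f_i(S) = sum of f_j(A) f_k(S - A) over A \<subseteq> S, and f_r({}) is the number of perfect matchings.
   A join takes time 3^|X(i)| because the pairs of disjoint subsets of the bag are enumerated directly.

   Since integers are unbounded and memory is initially 0, S can be coded by the sum of 2^v over
   v \<in> S, independently of the bag, and f_i(S) is stored in a cell whose index is this code times the
   number of nodes plus i; no translation between bags is needed and subsets outside the bag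
   automatically have value 0.  The nodes are processed in reverse breadth-first order. *)

theory Submission
  imports Defs "HOL-Library.Nat_Bijection"
begin

section \<open>Rooted trees\<close>

text \<open>An edge inside a bag stays uncounted until one of its ends is forgotten, so it enters
  the counts in exactly one place; the two sides of a join share no edge, and their counts multiply
  without correction. All recurrences rest on one fact about the tree: a vertex that occurs both
  inside and outside a subtree lies in the two bags at the edge by which the subtree hangs. Hence
  edges at forgotten vertices never leave the subtree.

  The nodes are numbered arbitrarily and the machine has no recursion, which is why an order must be
  computed at all. The size of the graph is the other obstacle, since nothing says that the number
  of edges is linear in \<open>n\<close>: each ordered pair of neighbours lies in a common bag, so
  the adjacency lists have at most \<open>N * (w + 1)^2\<close> entries, and
  \<open>(w + 1)^2\<close> is of order at most \<open>3 ^ w\<close>, and at most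
  \<open>w * 2 ^ w\<close> for positive \<open>w\<close>. A bag may have \<open>w + 1\<close>
  vertices, so a node other than a join costs at most a multiple of
  \<open>(w + 2) * 2 ^ (w + 1)\<close>, which is also of order at most \<open>3 ^ w\<close>.\<close>

lemma rtrancl_imp_distinct_path:
  assumes "(a, b) \<in> R\<^sup>*"
  shows "\<exists>p. p \<noteq> [] \<and> hd p = a \<and> last p = b \<and> distinct p \<and>
    successively (\<lambda>u v. (u, v) \<in> R) p \<and> (\<forall>x\<in>set p. (a, x) \<in> R\<^sup>*)"
  using assms
proof (induction rule: rtrancl_induct)
  case base
  show ?case by (intro exI[of _ "[a]"]) auto
next
  case (step y z)
  then obtain p where p: "p \<noteq> []" "hd p = a" "last p = y" "distinct p"
    "successively (\<lambda>u v. (u, v) \<in> R) p" "\<forall>x\<in>set p. (a, x) \<in> R\<^sup>*" by blast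
  show ?case
  proof (cases "z \<in> set p")
    \<comment> \<open>The walk has returned to \<open>z\<close>; cutting \<open>p\<close> off at its
      earlier occurrence keeps it distinct.\<close>
    case True
    then obtain q q' where q: "p = q @ z # q'" by (meson split_list)
    show ?thesis
      by (rule exI[of _ "q @ [z]"]) (use p q in \<open>auto simp: successively_append_iff hd_append\<close>)
  next
    case False
    have "(a, z) \<in> R\<^sup>*" using step by auto
    then show ?thesis using p False step
      by (intro exI[of _ "p @ [z]"]) (auto simp: successively_append_iff)
  qed
qed

text \<open>The set \<open>A\<close> serves to walk in a graph with vertices deleted; below it is
  the complement of a single vertex.\<close>

lemma path_imp_rtrancl:
  assumes "successively (\<lambda>u v. {u, v} \<in> F) p" "p \<noteq> []" "set p \<subseteq> A"
  shows "(hd p, last p) \<in> {(u, v). {u, v} \<in> F \<and> u \<in> A \<and> v \<in> A}\<^sup>*"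
  using assms
proof (induction p rule: induct_list012)
  case (3 x y zs)
  then have "(x, y) \<in> {(u, v). {u, v} \<in> F \<and> u \<in> A \<and> v \<in> A}" by auto
  moreover have "(y, last (y # zs)) \<in> {(u, v). {u, v} \<in> F \<and> u \<in> A \<and> v \<in> A}\<^sup>*"
    using 3 by auto
  ultimately show ?case by (auto intro: converse_rtrancl_into_rtrancl)
qed auto

section \<open>The parent relation of a rooted tree and its subtrees\<close>

locale rooted_tree =
  fixes I :: "'i set" and F :: "'i set set" and r :: 'i
  assumes tree: "is_tree I F" and root: "r \<in> I"
begin

abbreviation ch :: "'i \<Rightarrow> 'i set" where "ch \<equiv> children F r"

definition child_rel :: "('i \<times> 'i) set" where "child_rel = {(i, j). j \<in> ch i}"

definition desc :: "'i \<Rightarrow> 'i set" where "desc i = {a. (i, a) \<in> child_rel\<^sup>*}"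

lemma edge_in_nodes: "{a, b} \<in> F \<Longrightarrow> a \<in> I \<and> b \<in> I \<and> a \<noteq> b"
  using tree unfolding is_tree_def simple_graph_def by (fastforce simp: card_insert_if)

lemma no_cycle: "\<not> is_cycle F p"
  using tree unfolding is_tree_def by auto

lemma child_edge:
  assumes "j \<in> ch i" shows "{i, j} \<in> F"
  using assms unfolding children_def is_path_def by (auto simp: successively_append_iff)

lemma child_in_nodes: "j \<in> ch i \<Longrightarrow> i \<in> I \<and> j \<in> I"
  using child_edge edge_in_nodes by blast

lemma root_no_parent: "r \<notin> ch i"
proof
  assume "r \<in> ch i"
  then obtain p where "is_path F (p @ [i, r])" "hd (p @ [i, r]) = r"
    unfolding children_def by auto
  then show False unfolding is_path_def by (cases p) auto
qed

text \<open>Two parents of \<open>j\<close> would both be reached from the root without passing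
  through \<open>j\<close>; a simple path between them that avoids \<open>j\<close>, closed up
  through \<open>j\<close>, is a cycle.\<close>

lemma parent_unique:
  assumes "j \<in> ch i" "j \<in> ch i'"
  shows "i = i'"
proof (rule ccontr)
  assume ne: "i \<noteq> i'"
  \<comment> \<open>Adjacency in the tree with \<open>j\<close> deleted; it is symmetric, so the two
    walks from the root can be composed.\<close>
  define R where "R = {(u, v). {u, v} \<in> F \<and> u \<in> - {j} \<and> v \<in> - {j}}"
  have reach: "(r, x) \<in> R\<^sup>*" if "j \<in> ch x" for x
  proof -
    from that obtain p where p: "is_path F (p @ [x, j])" "hd (p @ [x, j]) = r"
      unfolding children_def by auto
    have "(hd (p @ [x]), last (p @ [x])) \<in> R\<^sup>*"
      unfolding R_def using p(1)
      by (intro path_imp_rtrancl) (auto simp: is_path_def successively_append_iff)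
    then show ?thesis using p(2) by (cases p) auto
  qed
  have "sym R" unfolding R_def sym_def by (auto simp: insert_commute)
  then have "sym (R\<^sup>*)" by (rule sym_rtrancl)
  then have "(i, i') \<in> R\<^sup>*"
    using reach[OF assms(1)] reach[OF assms(2)] by (meson symD rtrancl_trans)
  from rtrancl_imp_distinct_path[OF this] obtain q where q: "q \<noteq> []" "hd q = i" "last q = i'"
    "distinct q" "successively (\<lambda>u v. (u, v) \<in> R) q" "\<forall>x\<in>set q. (i, x) \<in> R\<^sup>*" by blast
  have ij: "{i, j} \<in> F" "{i', j} \<in> F" using assms child_edge by auto
  then have "i \<noteq> j" using edge_in_nodes by blast
  \<comment> \<open>Every vertex of \<open>q\<close> is reachable from \<open>i\<close> in
    \<open>R\<close>, and no step of \<open>R\<close> ends in \<open>j\<close>.\<close>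
  have "j \<notin> set q"
  proof
    assume "j \<in> set q"
    then have "(i, j) \<in> R\<^sup>*" using q(6) by blast
    then show False using \<open>i \<noteq> j\<close> by (cases rule: rtranclE) (auto simp: R_def)
  qed
  moreover have "2 \<le> length q" using q ne by (cases q; cases "tl q") auto
  moreover have "successively (\<lambda>u v. {u, v} \<in> F) q"
    using q(5) by (rule successively_mono) (auto simp: R_def)
  ultimately have "is_cycle F (q @ [j])"
    using q ij unfolding is_cycle_def is_path_def
    by (auto simp: successively_append_iff insert_commute)
  then show False using no_cycle by blast
qed

lemma path_from_root:
  assumes "v \<in> I"
  shows "\<exists>p. is_path F p \<and> p \<noteq> [] \<and> hd p = r \<and> last p = v"
proof -
  have "(r, v) \<in> {(a, b). {a, b} \<in> F}\<^sup>*"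
    using tree root assms unfolding is_tree_def connected_graph_def by blast
  from rtrancl_imp_distinct_path[OF this] show ?thesis unfolding is_path_def by auto
qed

text \<open>On the path from the root to \<open>i\<close>, either \<open>j\<close> is absent and can
  be appended, or it is the vertex just before \<open>i\<close>, since a longer piece from
  \<open>j\<close> to \<open>i\<close> would close to a cycle.\<close>

lemma edge_cases:
  assumes e: "{i, j} \<in> F"
  shows "j \<in> ch i \<or> i \<in> ch j"
proof -
  have ij: "i \<in> I" "i \<noteq> j" using edge_in_nodes[OF e] by auto
  from path_from_root[OF ij(1)] obtain p
    where p: "is_path F p" "p \<noteq> []" "hd p = r" "last p = i" by blast
  then obtain q where q: "p = q @ [i]" by (metis append_butlast_last_id)
  show ?thesis
  proof (cases "j \<in> set p")
    case False
    then have "is_path F (q @ [i, j])" using p q e ij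
      unfolding is_path_def by (auto simp: successively_append_iff)
    moreover have "hd (q @ [i, j]) = r" using p q by (cases q) auto
    ultimately show ?thesis unfolding children_def by blast
  next
    case True
    then have "j \<in> set q" using q ij by auto
    then obtain a b where ab: "q = a @ j # b" by (meson split_list)
    have path: "is_path F (j # b @ [i])"
      using p q ab unfolding is_path_def by (auto simp: successively_append_iff)
    have "b = []"
    proof (rule ccontr)
      assume "b \<noteq> []"
      then have "3 \<le> length (j # b @ [i])" by (cases b) auto
      then have "is_cycle F (j # b @ [i])" using path e unfolding is_cycle_def by auto
      then show False using no_cycle by blast
    qed
    then have "is_path F (a @ [j, i])" "hd (a @ [j, i]) = r"
      using p q ab by (auto simp: hd_append)
    then show ?thesis unfolding children_def by blast
  qed
qed

lemma reachable:
  assumes "v \<in> I" shows "(r, v) \<in> child_rel\<^sup>*"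
proof -
  have "(r, last p) \<in> child_rel\<^sup>*" if "is_path F p" "p \<noteq> []" "hd p = r" for p
    using that
  proof (induction p rule: rev_induct)
    case (snoc x xs)
    show ?case
    proof (cases xs rule: rev_cases)
      case Nil
      then show ?thesis using snoc by auto
    next
      case (snoc ys y)
      have "is_path F xs" "xs \<noteq> []" "hd xs = r"
        using snoc.prems \<open>xs = ys @ [y]\<close>
        by (auto simp: is_path_def successively_append_iff hd_append split: if_splits)
      then have "(r, y) \<in> child_rel\<^sup>*" using snoc.IH \<open>xs = ys @ [y]\<close> by auto
      moreover have "x \<in> ch y"
        using snoc.prems \<open>xs = ys @ [y]\<close> unfolding children_def by auto
      ultimately show ?thesis unfolding child_rel_def by (auto intro: rtrancl_into_rtrancl)
    qed
  qed auto
  then show ?thesis using path_from_root[OF assms] by blast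
qed

text \<open>Follow the path from the root to \<open>x\<close>. A cycle through a node enters it by
  its only parent, so it passes through that parent too; pushed back to the root this is impossible,
  since the root has no parent.\<close>

lemma child_rel_irrefl_trancl: "(x, x) \<notin> child_rel\<^sup>+"
proof
  assume x: "(x, x) \<in> child_rel\<^sup>+"
  then have "x \<in> I" by (cases rule: tranclE) (auto simp: child_rel_def dest: child_in_nodes)
  from reachable[OF this] have "(x, x) \<notin> child_rel\<^sup>+"
  proof (induction rule: rtrancl_induct)
    case base
    show ?case
    proof
      assume "(r, r) \<in> child_rel\<^sup>+"
      then show False by (cases rule: tranclE) (auto simp: child_rel_def root_no_parent)
    qed
  next
    case (step y z)
    show ?case
    proof
      assume "(z, z) \<in> child_rel\<^sup>+"
      then obtain p where "(z, p) \<in> child_rel\<^sup>*" "(p, z) \<in> child_rel"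
        by (meson tranclD2)
      moreover from this have "p = y" using step.hyps parent_unique by (auto simp: child_rel_def)
      ultimately have "(y, y) \<in> child_rel\<^sup>+" by (meson rtrancl_into_trancl2)
      then show False using step.IH by blast
    qed
  qed
  then show False using x by blast
qed

lemma desc_unfold: "desc i = insert i (\<Union>j\<in>ch i. desc j)"
  unfolding desc_def
  by (auto simp: child_rel_def elim: converse_rtranclE intro: converse_rtrancl_into_rtrancl)

lemma desc_refl: "i \<in> desc i" unfolding desc_def by auto

lemma desc_root: "I \<subseteq> desc r" using reachable unfolding desc_def by auto

lemma desc_in_nodes:
  assumes "i \<in> I" shows "desc i \<subseteq> I"
proof
  fix a assume "a \<in> desc i"
  then have "(i, a) \<in> child_rel\<^sup>*" unfolding desc_def by auto
  then show "a \<in> I"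
    by (cases rule: rtranclE) (use assms in \<open>auto simp: child_rel_def dest: child_in_nodes\<close>)
qed

lemma parent_not_desc: "j \<in> ch i \<Longrightarrow> i \<notin> desc j"
  using child_rel_irrefl_trancl unfolding desc_def child_rel_def
  by (metis (mono_tags, lifting) case_prodI mem_Collect_eq rtrancl_into_trancl2)

text \<open>Parents are unique, so the ancestors of a common descendant form a chain and one of
  \<open>j\<close>, \<open>k\<close> lies below the other; the way down to it ends with the step
  from \<open>i\<close>, which would put \<open>i\<close> below its own child.\<close>

lemma desc_disjoint:
  assumes jk: "j \<in> ch i" "k \<in> ch i" "j \<noteq> k"
  shows "desc j \<inter> desc k = {}"
proof (rule ccontr)
  assume "desc j \<inter> desc k \<noteq> {}"
  then obtain a where a: "(a, j) \<in> (child_rel\<inverse>)\<^sup>*" "(a, k) \<in> (child_rel\<inverse>)\<^sup>*"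
    unfolding desc_def by (auto simp: rtrancl_converse)
  have "single_valued (child_rel\<inverse>)"
    using parent_unique by (auto simp: single_valued_def child_rel_def)
  from single_valued_confluent[OF this a] have "k \<in> desc j \<or> j \<in> desc k"
    unfolding desc_def by (auto simp: rtrancl_converse)
  moreover have "y \<notin> desc x" if "x \<in> ch i" "y \<in> ch i" "x \<noteq> y" for x y
  proof
    assume "y \<in> desc x"
    then obtain p where "(x, p) \<in> child_rel\<^sup>*" "(p, y) \<in> child_rel"
      using \<open>x \<noteq> y\<close> unfolding desc_def by (auto elim: rtranclE)
    moreover from this have "p = i" using that parent_unique by (auto simp: child_rel_def)
    ultimately show False using parent_not_desc[OF that(1)] unfolding desc_def by auto
  qed
  ultimately show False using jk by blast
qed

text \<open>A subtree hangs on the rest by the edge to its parent alone; \<open>separator\<close>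
  rests on this.\<close>

lemma edge_leaving_desc:
  assumes "{a, b} \<in> F" "a \<in> desc j" "b \<notin> desc j"
  shows "a = j \<and> j \<in> ch b"
proof -
  have step: "y \<in> desc j" if "x \<in> desc j" "y \<in> ch x" for x y
    using that unfolding desc_def child_rel_def by (auto intro: rtrancl_into_rtrancl)
  have ab: "a \<in> ch b" using edge_cases[OF assms(1)] step assms by blast
  have "a = j"
  proof (rule ccontr)
    assume "a \<noteq> j"
    then obtain p where "(j, p) \<in> child_rel\<^sup>*" "(p, a) \<in> child_rel"
      using assms(2) unfolding desc_def by (auto elim: rtranclE)
    moreover from this have "p = b" using ab parent_unique by (auto simp: child_rel_def)
    ultimately show False using assms(3) unfolding desc_def by auto
  qed
  then show ?thesis using ab by auto
qed

end

section \<open>Counting matchings along a nice tree decomposition\<close>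

text \<open>For a simple graph on \<open>V\<close>, two extreme cases anchor the recursion:
  \<open>F = {}\<close> leaves only the empty matching, and \<open>F = U = V\<close> gives the
  perfect matchings.\<close>

definition partial_matchings :: "'a set set \<Rightarrow> 'a set \<Rightarrow> 'a set \<Rightarrow> 'a set set set" where
  "partial_matchings E F U =
     {M. M \<subseteq> E \<and> pairwise disjnt M \<and> \<Union>M = U \<and> (\<forall>e\<in>M. e \<inter> F \<noteq> {})}"

lemma partial_matchingsI:
  "M \<subseteq> E \<Longrightarrow> pairwise disjnt M \<Longrightarrow> \<Union>M = U \<Longrightarrow> (\<And>e. e \<in> M \<Longrightarrow> e \<inter> F \<noteq> {}) \<Longrightarrow>
    M \<in> partial_matchings E F U"
  unfolding partial_matchings_def by blast

lemma partial_matchingsD: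
  assumes "M \<in> partial_matchings E F U"
  shows "M \<subseteq> E" "pairwise disjnt M" "\<Union>M = U" "\<And>e. e \<in> M \<Longrightarrow> e \<inter> F \<noteq> {}"
  using assms unfolding partial_matchings_def by blast+

section \<open>The counts at a node and their recurrences\<close>

locale nice_decomposition = rooted_tree I F r
  for I :: "'i set" and F :: "'i set set" and r :: 'i +
  fixes V :: "'a set" and E :: "'a set set" and X :: "'i \<Rightarrow> 'a set"
  assumes graph: "simple_graph V E"
    and nice: "nice_tree_decomposition V E I F r X"
begin

definition verts_below :: "'i \<Rightarrow> 'a set" where "verts_below i = (\<Union>a\<in>desc i. X a)"

definition forgotten :: "'i \<Rightarrow> 'a set" where "forgotten i = verts_below i - X i"

text \<open>Without the test, a set \<open>S\<close> containing forgotten vertices would be counted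
  like \<open>S - forgotten i\<close>; the value 0 matches a table cell that is never
  written.\<close>

definition count :: "'i \<Rightarrow> 'a set \<Rightarrow> nat" where
  "count i S = (if S \<subseteq> X i
     then card (partial_matchings E (forgotten i) (forgotten i \<union> S)) else 0)"

lemma decomposition: "tree_decomposition V E I F X"
  using nice unfolding nice_tree_decomposition_def by auto

lemma bag_subset: "i \<in> I \<Longrightarrow> X i \<subseteq> V"
  using decomposition unfolding tree_decomposition_def by auto

lemma finite_V: "finite V" using graph unfolding simple_graph_def by auto

lemma finite_bag: "i \<in> I \<Longrightarrow> finite (X i)"
  using bag_subset finite_V finite_subset by blast

lemma edgeD: "e \<in> E \<Longrightarrow> e \<subseteq> V \<and> card e = 2"
  using graph unfolding simple_graph_def by auto

lemma finite_E: "finite E"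
  by (rule finite_subset[of _ "Pow V"]) (use edgeD finite_V in auto)

lemma finite_partial_matchings: "finite (partial_matchings E A U)"
  by (rule finite_subset[of _ "Pow E"]) (auto simp: partial_matchings_def finite_E)

text \<open>The nodes whose bags contain \<open>v\<close> are connected and lie on both sides of the
  edge between \<open>i\<close> and \<open>j\<close>; a walk between the sides must use this
  edge.\<close>

lemma separator:
  assumes j: "j \<in> ch i" and v: "v \<in> X a" "a \<in> desc j" "v \<in> X b" "b \<in> I" "b \<notin> desc j"
  shows "v \<in> X i \<and> v \<in> X j"
proof -
  have "j \<in> I" using j child_in_nodes by blast
  then have aI: "a \<in> I" using v desc_in_nodes by blast
  define J where "J = {i \<in> I. v \<in> X i}"
  have "v \<in> V" using v bag_subset by blast
  then have "connected_graph J (induced_edges F J)"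
    using decomposition unfolding tree_decomposition_def J_def by blast
  then have "(a, b) \<in> {(a, b). {a, b} \<in> induced_edges F J}\<^sup>*"
    using v aI unfolding connected_graph_def J_def by blast
  then have "b \<in> desc j \<or> (\<exists>c d. c \<in> desc j \<and> d \<notin> desc j \<and> {c, d} \<in> induced_edges F J)"
    by (induction rule: rtrancl_induct) (use v in auto)
  then obtain c d where cd: "c \<in> desc j" "d \<notin> desc j" "{c, d} \<in> F" "c \<in> J" "d \<in> J"
    using v(5) unfolding induced_edges_def by blast
  from edge_leaving_desc[OF cd(3,1,2)] have "c = j" "d = i"
    using j parent_unique by blast+
  then show ?thesis using cd unfolding J_def by auto
qed

text \<open>Otherwise \<open>separator\<close>, applied to the edge from \<open>i\<close> to its
  parent, would put \<open>v\<close> into \<open>X i\<close>.\<close>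

lemma forgotten_bag:
  assumes "i \<in> I" "v \<in> forgotten i" "v \<in> X b" "b \<in> I"
  shows "b \<in> desc i"
proof (rule ccontr)
  assume b: "b \<notin> desc i"
  from assms obtain a where a: "a \<in> desc i" "v \<in> X a" "v \<notin> X i"
    unfolding forgotten_def verts_below_def by auto
  \<comment> \<open>A node outside \<open>desc i\<close> exists, so \<open>i\<close> is not the root
    and has a parent.\<close>
  have "i \<noteq> r" using b assms(4) desc_root by auto
  from reachable[OF assms(1)] this obtain p where "i \<in> ch p"
    by (cases rule: rtranclE) (auto simp: child_rel_def)
  from separator[OF this a(2,1) assms(3,4) b] a show False by auto
qed

text \<open>Some bag contains \<open>e\<close>, hence a forgotten vertex, so this bag belongs to a
  node below \<open>i\<close>. This keeps the counts local to the subtree.\<close>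

lemma forgotten_edge:
  assumes "i \<in> I" "e \<in> E" "e \<inter> forgotten i \<noteq> {}"
  shows "e \<subseteq> forgotten i \<union> X i"
proof -
  from decomposition assms(2) obtain b where b: "b \<in> I" "e \<subseteq> X b"
    unfolding tree_decomposition_def by blast
  with assms forgotten_bag have "b \<in> desc i" by blast
  then show ?thesis using b unfolding forgotten_def verts_below_def by auto
qed

lemma bag_below: "X i \<subseteq> verts_below i"
  unfolding verts_below_def using desc_refl by auto

lemma partial_matchings_empty_forgotten:
  "partial_matchings E {} U = (if U = {} then {{}} else {})"
  unfolding partial_matchings_def by auto

lemma count_leaf:
  assumes "i \<in> I" "ch i = {}"
  shows "count i S = (if S = {} then 1 else 0)"
proof -
  have "X i = {}" using nice assms unfolding nice_tree_decomposition_def by blast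
  moreover have "forgotten i = {}"
    using assms desc_unfold[of i] unfolding forgotten_def verts_below_def by auto
  ultimately show ?thesis unfolding count_def by (auto simp: partial_matchings_empty_forgotten)
qed

text \<open>By \<open>separator\<close> the new vertex occurs nowhere below \<open>j\<close>, so
  both nodes have forgotten the same vertices. An edge covering the new vertex would meet
  \<open>forgotten j\<close> and hence lie below \<open>j\<close>.\<close>

lemma count_introduce:
  assumes i: "i \<in> I" and ch: "ch i = {j}" and v: "v \<notin> X j" "X i = insert v (X j)"
  shows "count i S = count j S"
proof -
  have j: "j \<in> ch i" "j \<in> I" using ch child_in_nodes by auto
  have v_new: "v \<notin> verts_below j"
    using separator[OF j(1)] parent_not_desc[OF j(1)] v i unfolding verts_below_def by blast
  have forg: "forgotten i = forgotten j"
    using ch v v_new desc_unfold[of i] bag_below[of j] unfolding forgotten_def verts_below_def by auto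
  show ?thesis
  proof (cases "v \<in> S")
    case False
    then show ?thesis unfolding count_def forg using v by auto
  next
    case True
    have "partial_matchings E (forgotten j) (forgotten j \<union> S) = {}"
    proof (rule ccontr)
      assume "\<not> ?thesis"
      then obtain M where M: "M \<in> partial_matchings E (forgotten j) (forgotten j \<union> S)" by blast
      then obtain e where e: "e \<in> M" "v \<in> e" using True unfolding partial_matchings_def by blast
      have "e \<subseteq> forgotten j \<union> X j"
        using forgotten_edge[OF j(2)] M e unfolding partial_matchings_def by blast
      then show False using v_new e bag_below[of j] unfolding forgotten_def by auto
    qed
    then show ?thesis unfolding count_def forg using True v by auto
  qed
qed

text \<open>Look at the edge covering \<open>v\<close>. If it already meets
  \<open>forgotten j\<close>, the whole matching was counted at \<open>j\<close> with
  \<open>v\<close> as a boundary vertex; if not, it is some \<open>{u, v}\<close> with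
  \<open>u \<in> S\<close>, and its removal leaves a matching counted at \<open>j\<close>.\<close>

lemma count_forget:
  assumes i: "i \<in> I" and ch: "ch i = {j}" and v: "v \<notin> X i" "X j = insert v (X i)"
    and S: "S \<subseteq> X i"
  shows "count i S = count j (insert v S) + (\<Sum>u | u \<in> S \<and> {u, v} \<in> E. count j (S - {u}))"
proof -
  have j: "j \<in> ch i" "j \<in> I" using ch child_in_nodes by auto
  define A where "A = forgotten j"
  have forg: "forgotten i = insert v A"
    using ch v desc_unfold[of i] bag_below[of j]
    unfolding A_def forgotten_def verts_below_def by auto
  have vA: "v \<notin> A" "A \<inter> X i = {}" using v unfolding A_def forgotten_def by auto
  define pm where "pm U = partial_matchings E A U" for U
  define N where "N = {u \<in> S. {u, v} \<in> E}"
  have vS: "v \<notin> S" using S v by auto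
  have finN: "finite N" using finite_subset[OF S finite_bag[OF i]] unfolding N_def by auto
  have split: "partial_matchings E (insert v A) (insert v A \<union> S) =
      pm (A \<union> insert v S) \<union> (\<Union>u\<in>N. insert {u, v} ` pm (A \<union> (S - {u})))" (is "?L = ?R")
  proof
    show "?L \<subseteq> ?R"
    proof
      fix M assume "M \<in> ?L"
      then have M: "M \<subseteq> E" "pairwise disjnt M" "\<Union>M = insert v A \<union> S"
        "\<forall>e\<in>M. e \<inter> insert v A \<noteq> {}" unfolding partial_matchings_def by auto
      then obtain e where e: "e \<in> M" "v \<in> e" by blast
      have only: "e' = e" if "e' \<in> M" "v \<in> e'" for e'
        using M(2) e that unfolding pairwise_def disjnt_def by blast
      show "M \<in> ?R"
      proof (cases "e \<inter> A = {}")
        case False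
        have "e' \<inter> A \<noteq> {}" if "e' \<in> M" for e'
          using M(4) only[OF that] that False by blast
        then have "M \<in> pm (A \<union> insert v S)"
          unfolding pm_def using M by (intro partial_matchingsI) auto
        then show ?thesis by blast
      next
        case True
        from edgeD M(1) e have "card e = 2" by auto
        then obtain u where u: "e = {u, v}" "u \<noteq> v"
          using e by (metis card_2_iff doubleton_eq_iff insert_iff singletonD)
        have uS: "u \<in> S" using M(3) e u True by auto
        have uN: "u \<in> N" using u uS e M(1) unfolding N_def by auto
        have disj: "e' \<inter> e = {}" if "e' \<in> M - {e}" for e'
          using M(2) e that unfolding pairwise_def disjnt_def by blast
        have "\<Union>(M - {e}) = \<Union>M - e" using disj e by auto
        also have "\<dots> = A \<union> (S - {u})" using M(3) u True vA vS by auto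
        finally have "\<Union>(M - {e}) = A \<union> (S - {u})" .
        moreover have "pairwise disjnt (M - {e})"
          using M(2) by (rule pairwise_subset) auto
        ultimately have "M - {e} \<in> pm (A \<union> (S - {u}))"
          unfolding pm_def
        proof (intro partial_matchingsI)
          fix e' assume e': "e' \<in> M - {e}"
          then have "v \<notin> e'" "e' \<inter> insert v A \<noteq> {}" using only M(4) by blast+
          then show "e' \<inter> A \<noteq> {}" by blast
        qed (use M(1) in auto)
        moreover have "M = insert {u, v} (M - {e})" using e u by auto
        ultimately show ?thesis using uN by blast
      qed
    qed
    show "?R \<subseteq> ?L"
    proof
      fix M assume "M \<in> ?R"
      then consider "M \<in> pm (A \<union> insert v S)"
        | u M' where "u \<in> N" "M' \<in> pm (A \<union> (S - {u}))" "M = insert {u, v} M'" by blast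
      then show "M \<in> ?L"
      proof cases
        case 1
        note M = partial_matchingsD[OF this[unfolded pm_def]]
        show ?thesis by (rule partial_matchingsI) (use M in blast)+
      next
        case 2
        note M' = partial_matchingsD[OF 2(2)[unfolded pm_def]]
        have u: "u \<in> S" "{u, v} \<in> E" "u \<notin> A" using 2 S vA unfolding N_def by auto
        have "disjnt {u, v} e" "disjnt e {u, v}" if "e \<in> M'" for e
          using M'(3) that u vA vS unfolding disjnt_def by blast+
        then have "pairwise disjnt M" using M'(2) 2(3) by (simp add: pairwise_insert)
        moreover have "\<Union>M = insert v A \<union> S" using M'(3) 2(3) u by auto
        ultimately show ?thesis
          by (intro partial_matchingsI) (use M'(1,4) 2(3) u in blast)+
      qed
    qed
  qed
  \<comment> \<open>These matchings leave \<open>v\<close> uncovered; hence inserting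
    \<open>{u, v}\<close> is injective, and the images for different \<open>u\<close> stay
    apart.\<close>
  have notin: "{u, v} \<notin> M" if "M \<in> pm (A \<union> (S - {u'}))" for u u' M
    using that vA vS unfolding pm_def partial_matchings_def by auto
  have card_image: "card (insert {u, v} ` pm (A \<union> (S - {u}))) = card (pm (A \<union> (S - {u})))" for u
    using notin by (intro card_image inj_onI) (metis insert_ident)
  \<comment> \<open>The edge \<open>{u, v}\<close> lies in the bag of \<open>j\<close>, outside
    \<open>A\<close>, but every edge of a matching in \<open>pm\<close> meets
    \<open>A\<close>.\<close>
  have disj1: "pm (A \<union> insert v S) \<inter> (\<Union>u\<in>N. insert {u, v} ` pm (A \<union> (S - {u}))) = {}"
  proof -
    have False if "insert {u, v} M \<in> pm (A \<union> insert v S)" "u \<in> N" for u M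
      using that vA S unfolding pm_def partial_matchings_def N_def by auto
    then show ?thesis by blast
  qed
  have disj2: "insert {u, v} ` pm (A \<union> (S - {u})) \<inter> insert {u', v} ` pm (A \<union> (S - {u'})) = {}"
    if "u \<noteq> u'" for u u'
  proof (rule ccontr)
    assume "\<not> ?thesis"
    then obtain M M' where "M' \<in> pm (A \<union> (S - {u'}))"
      and eq: "insert {u, v} M = insert {u', v} M'" by blast
    then have "{u, v} \<notin> M'" using notin by simp
    moreover have "{u, v} \<noteq> {u', v}" using that by (auto simp: doubleton_eq_iff)
    moreover have "{u, v} \<in> insert {u', v} M'" unfolding eq[symmetric] by simp
    ultimately show False by simp
  qed
  have fin: "finite (pm U)" for U unfolding pm_def by (rule finite_partial_matchings)
  have "card (partial_matchings E (insert v A) (insert v A \<union> S)) =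
      card (pm (A \<union> insert v S)) + card (\<Union>u\<in>N. insert {u, v} ` pm (A \<union> (S - {u})))"
    unfolding split by (rule card_Un_disjoint) (use fin finN disj1 in auto)
  also have "card (\<Union>u\<in>N. insert {u, v} ` pm (A \<union> (S - {u}))) =
      (\<Sum>u\<in>N. card (pm (A \<union> (S - {u}))))"
    by (subst card_UN_disjoint) (use fin finN disj2 card_image in auto)
  finally show ?thesis
    using S v unfolding count_def forg A_def[symmetric] pm_def N_def[symmetric]
    by (auto intro!: sum.cong)
qed

text \<open>An edge meeting one forgotten set stays within that set and the common bag, so it cannot
  meet the other. A matching therefore splits in exactly one way, and the summation set is the part
  of \<open>S\<close> covered by the edges that meet \<open>forgotten j\<close>.\<close>

lemma count_join:
  assumes i: "i \<in> I" and ch: "ch i = {j, k}" "j \<noteq> k" and S: "S \<subseteq> X i"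
  shows "count i S = (\<Sum>A\<in>Pow S. count j A * count k (S - A))"
proof -
  have jk: "j \<in> ch i" "j \<in> I" "k \<in> ch i" "k \<in> I" using ch child_in_nodes by auto
  have X: "X j = X i" "X k = X i"
    using nice i ch unfolding nice_tree_decomposition_def by blast+
  define A where "A = forgotten j"
  define B where "B = forgotten k"
  have forg: "forgotten i = A \<union> B"
    using ch X desc_unfold[of i] desc_unfold[of j] unfolding A_def B_def forgotten_def verts_below_def by auto
  have AX: "A \<inter> X i = {}" "B \<inter> X i = {}" unfolding A_def B_def forgotten_def using X by auto
  have AB: "A \<inter> B = {}"
  proof -
    have "v \<notin> B" if "v \<in> A" for v
    proof
      assume "v \<in> B"
      then obtain b where b: "b \<in> desc k" "v \<in> X b" unfolding B_def forgotten_def verts_below_def by auto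
      then have "b \<in> desc j"
        using forgotten_bag[OF jk(2)] that desc_in_nodes[OF jk(4)] unfolding A_def by blast
      then show False using b desc_disjoint[OF jk(1,3) ch(2)] by auto
    qed
    then show ?thesis by auto
  qed
  have eA: "e \<subseteq> A \<union> X i" if "e \<in> E" "e \<inter> A \<noteq> {}" for e
    using forgotten_edge[OF jk(2)] that X unfolding A_def by auto
  have eB: "e \<subseteq> B \<union> X i" if "e \<in> E" "e \<inter> B \<noteq> {}" for e
    using forgotten_edge[OF jk(4)] that X unfolding B_def by auto
  define pa where "pa T = partial_matchings E A (A \<union> T)" for T
  define pb where "pb T = partial_matchings E B (B \<union> T)" for T
  define P where "P = (SIGMA T:Pow S. pa T \<times> pb (S - T))"
  have fin: "finite (pa T)" "finite (pb T)" for T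
    unfolding pa_def pb_def by (rule finite_partial_matchings)+
  have "bij_betw (\<lambda>(T, M, M'). M \<union> M') P (partial_matchings E (A \<union> B) (A \<union> B \<union> S))"
  \<comment> \<open>The inverse sorts the edges by the side they meet; \<open>T\<close> is what the
    first side covers beyond \<open>A\<close>.\<close>
  proof (rule bij_betw_byWitness[where f' = "\<lambda>M. (\<Union>{e \<in> M. e \<inter> A \<noteq> {}} - A,
        {e \<in> M. e \<inter> A \<noteq> {}}, {e \<in> M. e \<inter> B \<noteq> {}})"])
    have parts: "{e \<in> M \<union> M'. e \<inter> A \<noteq> {}} = M \<and> {e \<in> M \<union> M'. e \<inter> B \<noteq> {}} = M'"
      if "T \<subseteq> S" "M \<in> pa T" "M' \<in> pb (S - T)" for T M M'
    proof -
      have filter_Un: "{e \<in> M \<union> M'. Q e} = M" if "\<And>e. e \<in> M \<Longrightarrow> Q e" "\<And>e. e \<in> M' \<Longrightarrow> \<not> Q e"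
        for Q and M M' :: "'a set set" using that by blast
      have MA: "e \<inter> B = {}" "e \<inter> A \<noteq> {}" if "e \<in> M" for e
      proof -
        note M = partial_matchingsD[OF \<open>M \<in> pa T\<close>[unfolded pa_def]]
        show "e \<inter> A \<noteq> {}" using M(4) that .
        then have "e \<subseteq> A \<union> X i" using eA[of e] M(1) that by blast
        then show "e \<inter> B = {}" using AB AX by blast
      qed
      have MB: "e \<inter> A = {}" "e \<inter> B \<noteq> {}" if "e \<in> M'" for e
      proof -
        note M = partial_matchingsD[OF \<open>M' \<in> pb (S - T)\<close>[unfolded pb_def]]
        show "e \<inter> B \<noteq> {}" using M(4) that .
        then have "e \<subseteq> B \<union> X i" using eB[of e] M(1) that by blast
        then show "e \<inter> A = {}" using AB AX by blast
      qed
      show ?thesis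
        using filter_Un[of M "\<lambda>e. e \<inter> A \<noteq> {}" M'] filter_Un[of M' "\<lambda>e. e \<inter> B \<noteq> {}" M] MA MB
        by (simp add: Un_commute)
    qed
    have "\<Union>M - A = T" if "T \<subseteq> S" "M \<in> pa T" for T M
      using that AX S unfolding pa_def partial_matchings_def by auto
    with parts show "\<forall>a\<in>P. (\<Union>{e \<in> (case a of (T, M, M') \<Rightarrow> M \<union> M'). e \<inter> A \<noteq> {}} - A,
        {e \<in> (case a of (T, M, M') \<Rightarrow> M \<union> M'). e \<inter> A \<noteq> {}},
        {e \<in> (case a of (T, M, M') \<Rightarrow> M \<union> M'). e \<inter> B \<noteq> {}}) = a"
      unfolding P_def by auto
    show "\<forall>M\<in>partial_matchings E (A \<union> B) (A \<union> B \<union> S).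
        (case (\<Union>{e \<in> M. e \<inter> A \<noteq> {}} - A, {e \<in> M. e \<inter> A \<noteq> {}}, {e \<in> M. e \<inter> B \<noteq> {}})
         of (T, M, M') \<Rightarrow> M \<union> M') = M"
      unfolding partial_matchings_def by auto
    show "(\<lambda>(T, M, M'). M \<union> M') ` P \<subseteq> partial_matchings E (A \<union> B) (A \<union> B \<union> S)"
    proof clarify
      fix T M M' assume "(T, M, M') \<in> P"
      then have T: "T \<subseteq> S" "M \<in> pa T" "M' \<in> pb (S - T)" unfolding P_def by auto
      then have U: "\<Union>M = A \<union> T" "\<Union>M' = B \<union> (S - T)"
        unfolding pa_def pb_def partial_matchings_def by auto
      have "(A \<union> T) \<inter> (B \<union> (S - T)) = {}" using AX AB T(1) S by auto
      then have "disjnt e e' \<and> disjnt e' e" if "e \<in> M" "e' \<in> M'" for e e'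
        using that U unfolding disjnt_def by blast
      moreover have "pairwise disjnt M" "pairwise disjnt M'"
        using T(2,3) unfolding pa_def pb_def partial_matchings_def by blast+
      ultimately have "pairwise disjnt (M \<union> M')" unfolding pairwise_def by blast
      moreover have "\<Union>(M \<union> M') = A \<union> B \<union> S" using U T(1) by auto
      moreover note partial_matchingsD[OF T(2)[unfolded pa_def]]
        partial_matchingsD[OF T(3)[unfolded pb_def]]
      ultimately show "M \<union> M' \<in> partial_matchings E (A \<union> B) (A \<union> B \<union> S)"
        by (intro partial_matchingsI) blast+
    qed
    show "(\<lambda>M. (\<Union>{e \<in> M. e \<inter> A \<noteq> {}} - A, {e \<in> M. e \<inter> A \<noteq> {}}, {e \<in> M. e \<inter> B \<noteq> {}})) `
        partial_matchings E (A \<union> B) (A \<union> B \<union> S) \<subseteq> P"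
    proof (rule image_subsetI)
      fix M assume "M \<in> partial_matchings E (A \<union> B) (A \<union> B \<union> S)"
      then have M: "M \<subseteq> E" "pairwise disjnt M" "\<Union>M = A \<union> B \<union> S" "\<forall>e\<in>M. e \<inter> (A \<union> B) \<noteq> {}"
        unfolding partial_matchings_def by auto
      define MA where "MA = {e \<in> M. e \<inter> A \<noteq> {}}"
      define MB where "MB = {e \<in> M. e \<inter> B \<noteq> {}}"
      have sub: "\<Union>MA \<subseteq> A \<union> X i" "\<Union>MB \<subseteq> B \<union> X i"
        using M(1) eA eB unfolding MA_def MB_def by blast+
      have "M = MA \<union> MB" using M(4) unfolding MA_def MB_def by auto
      then have un: "\<Union>MA \<union> \<Union>MB = A \<union> B \<union> S" using M(3) by auto
      have "e \<inter> e' = {}" if "e \<in> MA" "e' \<in> MB" for e e'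
      proof -
        have "e \<subseteq> A \<union> X i" "e' \<inter> B \<noteq> {}" using that M(1) eA[of e] unfolding MA_def MB_def by auto
        then have "e \<noteq> e'" using AB AX by blast
        then show ?thesis
          using M(2) that unfolding MA_def MB_def pairwise_def disjnt_def by blast
      qed
      then have disj: "\<Union>MA \<inter> \<Union>MB = {}" by blast
      \<comment> \<open>Edges of \<open>MB\<close> lie in \<open>B \<union> X i\<close>, which is
        disjoint from \<open>A\<close>, so only \<open>MA\<close> can cover \<open>A\<close>;
        likewise for \<open>B\<close>.\<close>
      have "A \<subseteq> \<Union>MA" "B \<subseteq> \<Union>MB" using un sub AB AX by blast+
      then have U: "\<Union>MA = A \<union> (\<Union>MA - A)" "\<Union>MB = B \<union> (S - (\<Union>MA - A))" "\<Union>MA - A \<subseteq> S"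
        using sub un disj AB AX S by blast+
      have "MA \<in> pa (\<Union>MA - A)" unfolding pa_def
      proof (rule partial_matchingsI)
        show "pairwise disjnt MA" using M(2) by (rule pairwise_subset) (auto simp: MA_def)
      qed (use M(1) U in \<open>auto simp: MA_def\<close>)
      moreover have "MB \<in> pb (S - (\<Union>MA - A))" unfolding pb_def
      proof (rule partial_matchingsI)
        show "pairwise disjnt MB" using M(2) by (rule pairwise_subset) (auto simp: MB_def)
        show "\<Union>MB = B \<union> (S - (\<Union>MA - A))" by (rule U(2))
      qed (use M(1) in \<open>auto simp: MB_def\<close>)
      moreover note U(3)
      ultimately have "MA \<in> pa (\<Union>MA - A)" "MB \<in> pb (S - (\<Union>MA - A))" "\<Union>MA - A \<subseteq> S" by blast+
      then have "(\<Union>MA - A, MA, MB) \<in> P" unfolding P_def by auto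
      then show "(\<Union>{e \<in> M. e \<inter> A \<noteq> {}} - A, {e \<in> M. e \<inter> A \<noteq> {}}, {e \<in> M. e \<inter> B \<noteq> {}}) \<in> P"
        unfolding MA_def MB_def .
    qed
  qed
  then have "card (partial_matchings E (A \<union> B) (A \<union> B \<union> S)) = card P"
    using bij_betw_same_card by metis
  also have "\<dots> = (\<Sum>T\<in>Pow S. card (pa T \<times> pb (S - T)))"
    unfolding P_def using finite_subset[OF S finite_bag[OF i]] fin by (intro card_SigmaI) auto
  finally have "card (partial_matchings E (A \<union> B) (A \<union> B \<union> S)) =
      (\<Sum>T\<in>Pow S. card (pa T) * card (pb (S - T)))" by (simp add: card_cartesian_product)
  then show ?thesis
    using S X unfolding count_def forg A_def[symmetric] B_def[symmetric] pa_def pb_def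
    by (auto intro!: sum.cong)
qed

text \<open>The root bag is empty and every bag lies below the root, so all vertices are forgotten
  at \<open>r\<close>. Edges are nonempty, so each of them meets \<open>V\<close>, and disjointness
  with union \<open>V\<close> says the same as unique cover.\<close>

lemma count_root: "count r {} = num_perfect_matchings V E"
proof -
  have "X r = {}" using nice unfolding nice_tree_decomposition_def by auto
  moreover have "verts_below r = V"
    using decomposition desc_root desc_in_nodes[OF root] bag_subset
    unfolding verts_below_def tree_decomposition_def by blast
  ultimately have V: "forgotten r = V" unfolding forgotten_def by auto
  have "partial_matchings E V V = {M. perfect_matching V E M}"
  proof (intro set_eqI iffI; clarsimp)
    fix M assume M: "M \<in> partial_matchings E V V"
    have "\<exists>!e. e \<in> M \<and> v \<in> e" if v: "v \<in> V" for v
    proof -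
      note M' = partial_matchingsD[OF M]
      from v M'(3) obtain e where e: "e \<in> M" "v \<in> e" by blast
      have "e' = e" if "e' \<in> M" "v \<in> e'" for e'
        using M'(2) e that unfolding pairwise_def disjnt_def by blast
      with e show ?thesis by blast
    qed
    then show "perfect_matching V E M"
      using partial_matchingsD(1)[OF M] unfolding perfect_matching_def by blast
  next
    fix M assume M: "perfect_matching V E M"
    have sub: "e \<subseteq> V" "e \<noteq> {}" if "e \<in> M" for e
      using M that edgeD[of e] unfolding perfect_matching_def by auto
    have "pairwise disjnt M"
    proof (rule pairwiseI)
      fix e e' assume "e \<in> M" "e' \<in> M" "e \<noteq> e'"
      have "v \<notin> e'" if "v \<in> e" for v
      proof
        assume "v \<in> e'"
        moreover have "v \<in> V" using sub \<open>e \<in> M\<close> that by blast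
        ultimately have "e = e'"
          using M that \<open>e \<in> M\<close> \<open>e' \<in> M\<close> unfolding perfect_matching_def by blast
        then show False using \<open>e \<noteq> e'\<close> by blast
      qed
      then show "disjnt e e'" unfolding disjnt_def by blast
    qed
    moreover have "\<Union>M = V"
    proof
      show "V \<subseteq> \<Union>M" using M unfolding perfect_matching_def by blast
    qed (use sub in blast)
    moreover have "M \<subseteq> E" using M unfolding perfect_matching_def by blast
    ultimately show "M \<in> partial_matchings E V V"
      by (intro partial_matchingsI) (use sub in blast)+
  qed
  then show ?thesis unfolding count_def V num_perfect_matchings_def by auto
qed

end

section \<open>Weakest preconditions with running time\<close>

text \<open>A total-correctness statement: a halting run exists and \<open>Q\<close> sees its
  running time, so that cost and result are proved together.\<close>

definition wp :: "com \<Rightarrow> state \<Rightarrow> (nat \<Rightarrow> state \<Rightarrow> bool) \<Rightarrow> bool" where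
  "wp c s Q \<longleftrightarrow> (\<exists>k t. exec c s k t \<and> Q k t)"

lemma wp_mono: "wp c s Q \<Longrightarrow> (\<And>k t. Q k t \<Longrightarrow> Q' k t) \<Longrightarrow> wp c s Q'"
  unfolding wp_def by blast

lemma wp_Assign:
  "wp (Assign x a b) s Q \<longleftrightarrow> Q (acost a + acost b + 1) (s(x := (s x)(aval a s := aval b s)))"
  unfolding wp_def by (metis exec_Assign exec_AssignE)

lemma wp_Seq: "wp (Seq c d) s Q \<longleftrightarrow> wp c s (\<lambda>k t. wp d t (\<lambda>l u. Q (k + l) u))"
  unfolding wp_def by (fastforce elim: exec_SeqE intro: exec_Seq)

lemma wp_If:
  "wp (If b c d) s Q \<longleftrightarrow>
    (if bval b s then wp c s (\<lambda>k. Q (bcost b + 1 + k)) else wp d s (\<lambda>k. Q (bcost b + 1 + k)))"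
proof -
  have "exec (If b c d) s k t \<longleftrightarrow>
      (\<exists>l. k = bcost b + 1 + l \<and> (if bval b s then exec c s l t else exec d s l t))" for k t
    by (rule iffI, erule exec_IfE) (auto intro: exec_IfTrue[simplified] exec_IfFalse[simplified] split: if_splits)
  then show ?thesis unfolding wp_def by auto
qed

lemmas wp_simps = wp_Assign wp_Seq wp_If

abbreviation Var :: "string \<Rightarrow> aexp" where "Var x \<equiv> Cell x (Const 0)"

abbreviation Set :: "string \<Rightarrow> aexp \<Rightarrow> com" where "Set x a \<equiv> Assign x (Const 0) a"

definition For :: "string \<Rightarrow> aexp \<Rightarrow> aexp \<Rightarrow> com \<Rightarrow> com" where
  "For x a b c = Seq (Set x a) (While (Less (Var x) b) (Seq c (Set x (Add (Var x) (Const 1)))))"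

text \<open>The bound \<open>b\<close> is evaluated anew in each round, so \<open>ctrl\<close> ties
  it to the counter by the number of rounds left; the counter may start anywhere. Besides the body,
  a round costs \<open>acost b + 4\<close> for the test and 6 for the increment; the first
  assignment costs \<open>acost a + 2\<close> and the last test \<open>acost b + 4\<close>.\<close>

lemma wp_For:
  assumes init: "J 0 (s(x := (s x)(0 := aval a s)))"
    and ctrl: "\<And>k t. k \<le> m \<Longrightarrow> J k t \<Longrightarrow> aval b t = t x 0 + int (m - k)"
    and body: "\<And>k t. k < m \<Longrightarrow> J k t \<Longrightarrow>
      wp c t (\<lambda>l u. l \<le> T k \<and> J (Suc k) (u(x := (u x)(0 := u x 0 + 1))))"
    and post: "\<And>l t. J m t \<Longrightarrow> l \<le> (\<Sum>k<m. T k + (acost b + 10)) + acost a + acost b + 6 \<Longrightarrow> Q l t"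
  shows "wp (For x a b c) s Q"
proof -
  define W where "W = While (Less (Var x) b) (Seq c (Set x (Add (Var x) (Const 1))))"
  have "\<exists>l u. exec W t l u \<and> J m u \<and> l \<le> (\<Sum>i=k..<m. T i + (acost b + 10)) + acost b + 4"
    if "k \<le> m" "J k t" for k t
    using that
  proof (induction "m - k" arbitrary: k t)
    case 0
    then have "k = m" by simp
    then have "\<not> bval (Less (Var x) b) t" using ctrl[of m t] 0 by simp
    from exec_WhileFalse[OF this] show ?case using 0 \<open>k = m\<close> unfolding W_def by fastforce
  next
    case (Suc d)
    then have k: "k < m" by simp
    then have b: "bval (Less (Var x) b) t" using ctrl[of k t] Suc.prems by simp
    from body[OF k Suc.prems(2)] obtain l u where u: "exec c t l u" "l \<le> T k"
      "J (Suc k) (u(x := (u x)(0 := u x 0 + 1)))" unfolding wp_def by blast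
    from Suc.hyps(1)[OF _ _ u(3)] Suc.hyps(2) k obtain l' u' where u':
      "exec W (u(x := (u x)(0 := u x 0 + 1))) l' u'" "J m u'"
      "l' \<le> (\<Sum>i=Suc k..<m. T i + (acost b + 10)) + acost b + 4" by fastforce
    have "exec (Seq c (Set x (Add (Var x) (Const 1)))) t (l + 6) (u(x := (u x)(0 := u x 0 + 1)))"
      using exec_Seq[OF u(1) exec_Assign[of x "Const 0" "Add (Var x) (Const 1)"]]
      by (simp add: numeral_eq_Suc)
    from exec_WhileTrue[OF b this u'(1)[unfolded W_def]]
    show ?case using u'(2,3) u(2) k unfolding W_def
      by (fastforce simp: sum.atLeast_Suc_lessThan)
  qed
  from this[OF _ init] obtain l u where
    "exec W (s(x := (s x)(0 := aval a s))) l u" "J m u"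
    "l \<le> (\<Sum>i=0..<m. T i + (acost b + 10)) + acost b + 4" by auto
  moreover have "exec (Set x a) s (acost a + 2) (s(x := (s x)(0 := aval a s)))"
    using exec_Assign[of x "Const 0" a s] by simp
  ultimately have "exec (For x a b c) s (acost a + 2 + l) u" and "J m u"
    and "acost a + 2 + l \<le> (\<Sum>k<m. T k + (acost b + 10)) + acost a + acost b + 6"
    unfolding For_def W_def[symmetric] by (blast intro: exec_Seq, simp_all add: atLeast0LessThan)
  with post show ?thesis unfolding wp_def by blast
qed

lemma wp_For_uniform:
  assumes "J 0 (s(x := (s x)(0 := aval a s)))"
    and "\<And>k t. k \<le> m \<Longrightarrow> J k t \<Longrightarrow> aval b t = t x 0 + int (m - k)"
    and "\<And>k t. k < m \<Longrightarrow> J k t \<Longrightarrow>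
      wp c t (\<lambda>l u. l \<le> K \<and> J (Suc k) (u(x := (u x)(0 := u x 0 + 1))))"
    and "\<And>l t. J m t \<Longrightarrow> l \<le> m * (K + acost b + 10) + acost a + acost b + 6 \<Longrightarrow> Q l t"
  shows "wp (For x a b c) s Q"
  by (rule wp_For[of J _ _ _ m _ _ "\<lambda>_. K"]) (use assms in \<open>auto simp: algebra_simps\<close>)

text \<open>All that a traversal needs: the segments follow each other and hold the entries. The
  loop proofs thus need not unfold \<open>offsets\<close>.\<close>

definition stored :: "nat list list \<Rightarrow> (int \<Rightarrow> int) \<Rightarrow> (int \<Rightarrow> int) \<Rightarrow> bool" where
  "stored xss p a \<longleftrightarrow> (\<forall>i<length xss.
     p (int i + 1) = p (int i) + int (length (xss ! i)) \<and>
     (\<forall>k<length (xss ! i). a (p (int i) + int k) = int (xss ! i ! k)))"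

lemma stored_offsets: "stored xss (array_of (offsets xss)) (array_of (concat xss))"
proof -
  define L where "L i = length (concat (take i xss))" for i
  have off: "array_of (offsets xss) (int i) = int (L i)" if "i \<le> length xss" for i
    using that unfolding array_of_def offsets_def L_def
    by (auto simp del: upt_Suc)
  have step: "L (Suc i) = L i + length (xss ! i)" if "i < length xss" for i
    using that unfolding L_def by (simp add: take_Suc_conv_app_nth)
  have "array_of (concat xss) (int (L i) + int k) = int (xss ! i ! k)"
    if "i < length xss" "k < length (xss ! i)" for i k
  proof -
    have "xss = take i xss @ xss ! i # drop (Suc i) xss" using that by (simp add: id_take_nth_drop)
    then have "concat xss = concat (take i xss) @ xss ! i @ concat (drop (Suc i) xss)"
      by (metis concat.simps(2) concat_append)
    then show ?thesis using that unfolding array_of_def L_def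
      by (auto simp: nth_append nat_add_distrib)
  qed
  then show ?thesis
    unfolding stored_def using off step by (metis Suc_leI less_or_eq_imp_le of_nat_Suc of_nat_add add.commute)
qed

section \<open>Powers of two, adjacency matrix and node order\<close>

definition pow_prog :: com where
  "pow_prog = Seq (Assign ''pow'' (Const 0) (Const 1))
     (For ''v'' (Const 0) (Var ''n'')
        (Assign ''pow'' (Add (Var ''v'') (Const 1)) (Mul (Const 2) (Cell ''pow'' (Var ''v'')))))"

lemma wp_pow_prog:
  assumes "s ''n'' 0 = int n"
  shows "wp pow_prog s (\<lambda>c t. c \<le> 40 * n + 40 \<and> (\<forall>y. y \<notin> {''pow'', ''v''} \<longrightarrow> t y = s y) \<and>
           (\<forall>v\<le>n. t ''pow'' (int v) = 2 ^ v))"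
  unfolding pow_prog_def wp_simps
  by (rule wp_For_uniform[where m = n and K = 12 and J = "\<lambda>k t.
        (\<forall>y. y \<notin> {''pow'', ''v''} \<longrightarrow> t y = s y) \<and> t ''v'' 0 = int k \<and>
        (\<forall>v\<le>k. t ''pow'' (int v) = 2 ^ v)"])
     (use assms in \<open>simp_all add: wp_simps le_Suc_eq\<close>)

text \<open>Only the cells of edges are written. The other cells of the matrix keep their initial 0,
  so the cost follows the adjacency lists and not the square of \<open>n\<close>.\<close>

definition adj_prog :: com where
  "adj_prog = For ''v'' (Const 0) (Var ''n'')
     (For ''e'' (Cell ''adj_start'' (Var ''v'')) (Cell ''adj_start'' (Add (Var ''v'') (Const 1)))
        (Assign ''mat'' (Add (Mul (Var ''v'') (Var ''n'')) (Cell ''adj'' (Var ''e''))) (Const 1)))"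

lemma wp_adj_prog:
  assumes n: "s ''n'' 0 = int n" "length adj = n"
    and st: "stored adj (s ''adj_start'') (s ''adj'')" and zero: "s ''mat'' = (\<lambda>z. 0)"
    and bound: "\<And>v. v < n \<Longrightarrow> set (adj ! v) \<subseteq> {..<n}"
  shows "wp adj_prog s (\<lambda>c t. c \<le> 50 * (n + length (concat adj) + 1) \<and>
           (\<forall>y. y \<notin> {''mat'', ''v'', ''e''} \<longrightarrow> t y = s y) \<and>
           (\<forall>v<n. \<forall>u<n. t ''mat'' (int v * int n + int u) = of_bool (u \<in> set (adj ! v))))"
proof -
  define frame where "frame t \<longleftrightarrow> (\<forall>y. y \<notin> {''mat'', ''v'', ''e''} \<longrightarrow> t y = s y)" for t :: state
  define A where "A k = (\<Union>v<k. (\<lambda>u. int v * int n + int u) ` set (adj ! v))" for k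
  show ?thesis
    unfolding adj_prog_def
  \<comment> \<open>The cost of a row depends on its degree; a uniform bound per row would lose
    linearity in the total length of the lists.\<close>
  proof (rule wp_For[where m = n and T = "\<lambda>v. length (adj ! v) * 30 + 30" and
        J = "\<lambda>k t. frame t \<and> t ''v'' 0 = int k \<and> t ''mat'' = (\<lambda>z. of_bool (z \<in> A k))"])
    fix k t assume k: "k < n" and J: "frame t \<and> t ''v'' 0 = int k \<and> t ''mat'' = (\<lambda>z. of_bool (z \<in> A k))"
    from J have t: "t ''n'' = s ''n''" "t ''adj_start'' = s ''adj_start''" "t ''adj'' = s ''adj''"
      unfolding frame_def by auto
    have pos: "s ''adj_start'' (int k + 1) = s ''adj_start'' (int k) + int (length (adj ! k))"
      and elem: "\<And>q. q < length (adj ! k) \<Longrightarrow> s ''adj'' (s ''adj_start'' (int k) + int q) = int (adj ! k ! q)"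
      using st k n unfolding stored_def by auto
    show "wp (For ''e'' (Cell ''adj_start'' (Var ''v'')) (Cell ''adj_start'' (Add (Var ''v'') (Const 1)))
        (Assign ''mat'' (Add (Mul (Var ''v'') (Var ''n'')) (Cell ''adj'' (Var ''e''))) (Const 1))) t
      (\<lambda>l u. l \<le> length (adj ! k) * 30 + 30 \<and> frame (u(''v'' := (u ''v'')(0 := u ''v'' 0 + 1))) \<and>
        (u(''v'' := (u ''v'')(0 := u ''v'' 0 + 1))) ''v'' 0 = int (Suc k) \<and>
        (u(''v'' := (u ''v'')(0 := u ''v'' 0 + 1))) ''mat'' = (\<lambda>z. of_bool (z \<in> A (Suc k))))"
    proof (rule wp_For_uniform[where m = "length (adj ! k)" and K = 15 and
          J = "\<lambda>q t'. (\<forall>y. y \<notin> {''mat'', ''e''} \<longrightarrow> t' y = t y) \<and>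
            t' ''e'' 0 = s ''adj_start'' (int k) + int q \<and>
            t' ''mat'' = (\<lambda>z. of_bool (z \<in> A k \<union> (\<lambda>u. int k * int n + int u) ` set (take q (adj ! k))))"], goal_cases)
      case 1
      then show ?case using J t by simp
    next
      case (2 q t')
      then show ?case using J t pos by simp
    next
      case (3 q t')
      then show ?case using J t n elem
        by (simp add: wp_simps take_Suc_conv_app_nth fun_eq_iff)
    next
      case (4 l t')
      then show ?case using J
        by (simp add: frame_def A_def lessThan_Suc Un_commute)
    qed
  next
    fix l t assume J: "frame t \<and> t ''v'' 0 = int n \<and> t ''mat'' = (\<lambda>z. of_bool (z \<in> A n))"
      and l: "l \<le> (\<Sum>k<n. length (adj ! k) * 30 + 30 + (acost (Var ''n'') + 10)) +
        acost (Const 0) + acost (Var ''n'') + 6"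
    have "(\<Sum>k<n. length (adj ! k)) = length (concat adj)"
      using n by (simp add: length_concat sum_list_sum_nth atLeast0LessThan)
    then have "l \<le> 50 * (n + length (concat adj) + 1)"
      using l by (simp add: sum.distrib sum_distrib_right[symmetric])
    moreover have "int v * int n + int u \<in> A n \<longleftrightarrow> u \<in> set (adj ! v)" if "v < n" "u < n" for u v
    proof -
      \<comment> \<open>Row-major positions are unique because every neighbour is below
        \<open>n\<close>.\<close>
      have "v = v' \<and> u = u'" if "int v * int n + int u = int v' * int n + int u'" "u' < n" for v' u'
      proof -
        have eq: "u + n * v = u' + n * v'" using that(1) by (metis mult.commute of_nat_add of_nat_eq_iff of_nat_mult add.commute)
        from arg_cong[OF eq, of "\<lambda>x. x mod n"] have "u = u'" using \<open>u < n\<close> \<open>u' < n\<close> by simp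
        moreover have "v = v'" using eq \<open>u = u'\<close> \<open>u < n\<close> by simp
        ultimately show ?thesis by simp
      qed
      note uniq = this
      show ?thesis
      proof
        assume "int v * int n + int u \<in> A n"
        then obtain v' u' where v': "v' < n" "u' \<in> set (adj ! v')"
          "int v * int n + int u = int v' * int n + int u'" unfolding A_def by blast
        then have "u' < n" using bound by blast
        then show "u \<in> set (adj ! v)" using uniq v' by blast
      next
        assume "u \<in> set (adj ! v)"
        then show "int v * int n + int u \<in> A n" using that unfolding A_def by blast
      qed
    qed
    ultimately show "l \<le> 50 * (n + length (concat adj) + 1) \<and>
           (\<forall>y. y \<notin> {''mat'', ''v'', ''e''} \<longrightarrow> t y = s y) \<and>
           (\<forall>v<n. \<forall>u<n. t ''mat'' (int v * int n + int u) = of_bool (u \<in> set (adj ! v)))"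
      using J unfolding frame_def by simp
  qed (use n zero in \<open>simp_all add: frame_def A_def\<close>)
qed

text \<open>The queue after its first \<open>h\<close> entries have been expanded. Nothing is
  removed from it: \<open>h\<close> is the read position, and after \<open>N\<close> rounds the
  queue is the node order itself.\<close>

fun bfs :: "nat list list \<Rightarrow> nat \<Rightarrow> nat \<Rightarrow> nat list" where
  "bfs chs r 0 = [r]"
| "bfs chs r (Suc h) = bfs chs r h @ chs ! (bfs chs r h ! h)"

locale tree_lists = rooted_tree "{..<N}" F r for N :: nat and F r +
  fixes chs :: "nat list list"
  assumes chs: "lists_represent N (children F r) chs"
begin

lemma chs_nth:
  "i < N \<Longrightarrow> distinct (chs ! i) \<and> set (chs ! i) = ch i" "length chs = N"
  using chs unfolding lists_represent_def by auto

text \<open>Children of the entry at position \<open>h\<close> are new, since an earlier occurrence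
  would come from the same parent expanded before. The queue does not run dry early, since a fully
  expanded queue is closed under children and thus contains every node. The last clause, a parent
  before each later entry, is kept for \<open>bfs_child_later\<close>.\<close>

lemma bfs_invariant:
  assumes "h \<le> N"
  shows "distinct (bfs chs r h) \<and> set (bfs chs r h) \<subseteq> {..<N} \<and> bfs chs r h ! 0 = r \<and>
    h \<le> length (bfs chs r h) \<and> (h < N \<longrightarrow> h < length (bfs chs r h)) \<and>
    set (bfs chs r h) = insert r (\<Union>q<h. ch (bfs chs r h ! q)) \<and>
    (\<forall>q. 0 < q \<and> q < length (bfs chs r h) \<longrightarrow> (\<exists>p<q. bfs chs r h ! q \<in> ch (bfs chs r h ! p)))"
  using assms
proof (induction h)
  case 0
  then show ?case using root by auto
next
  case (Suc h)
  define L where "L = bfs chs r h"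
  define i where "i = L ! h"
  define L' where "L' = L @ chs ! i"
  from Suc have dist: "distinct L" and sub: "set L \<subseteq> {..<N}" and hd: "L ! 0 = r" and len: "h < length L"
    and setL: "set L = insert r (\<Union>q<h. ch (L ! q))"
    and par: "\<And>q. 0 < q \<Longrightarrow> q < length L \<Longrightarrow> \<exists>p<q. L ! q \<in> ch (L ! p)"
    unfolding L_def by auto
  have iN: "i < N" using sub nth_mem[OF len] unfolding i_def by auto
  note ci = chs_nth(1)[OF iN]
  have nth: "L' ! q = L ! q" if "q < length L" for q using that unfolding L'_def by (simp add: nth_append)
  have disj: "x \<notin> set L" if x: "x \<in> ch i" for x
  proof
    assume "x \<in> set L"
    then obtain q where "q < h" "x \<in> ch (L ! q)" using setL x root_no_parent by auto
    then have "L ! q = L ! h" using parent_unique[OF x] unfolding i_def by auto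
    then show False using \<open>q < h\<close> len dist by (simp add: nth_eq_iff_index_eq)
  qed
  have distL': "distinct L'" using dist ci disj unfolding L'_def by auto
  have subL': "set L' \<subseteq> {..<N}" using sub ci child_in_nodes unfolding L'_def by auto
  have setL': "set L' = insert r (\<Union>q<Suc h. ch (L' ! q))"
    using setL ci len nth unfolding L'_def i_def by (auto simp: lessThan_Suc)
  have parL': "\<exists>p<q. L' ! q \<in> ch (L' ! p)" if q: "0 < q" "q < length L'" for q
  proof (cases "q < length L")
    case True
    then show ?thesis using par[OF q(1) True] nth by (metis order.strict_trans)
  next
    case False
    then have "L' ! q \<in> set (chs ! i)" using q unfolding L'_def by (auto simp: nth_append)
    then show ?thesis using False len ci nth[OF len] unfolding i_def
      by (intro exI[of _ h]) auto
  qed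
  have "Suc h < length L'" if "Suc h < N"
  proof (rule ccontr)
    assume "\<not> ?thesis"
    then have len': "length L' = Suc h" using len unfolding L'_def by auto
    have "x \<in> set L'" if "(r, x) \<in> child_rel\<^sup>*" for x
      using that
    proof (induction rule: rtrancl_induct)
      case base
      then show ?case using setL' by simp
    next
      case (step y z)
      then obtain q where "q < Suc h" "L' ! q = y" using len' by (metis in_set_conv_nth)
      then show ?case using step setL' unfolding child_rel_def by blast
    qed
    then have "{..<N} \<subseteq> set L'" using reachable by auto
    then have "N \<le> card (set L')" by (metis card_lessThan card_mono List.finite_set)
    then show False using that len' distL' by (simp add: distinct_card)
  qed
  moreover have "L' ! 0 = r" using nth[of 0] hd len by (metis gr_zeroI less_zeroE)
  moreover have "Suc h \<le> length L'" using len unfolding L'_def by auto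
  moreover have "bfs chs r (Suc h) = L'" unfolding L'_def L_def i_def by simp
  ultimately show ?case using distL' subL' setL' parL' by metis
qed

lemma length_bfs_le: "h \<le> N \<Longrightarrow> length (bfs chs r h) \<le> N"
  using bfs_invariant[of h] by (metis card_lessThan card_mono distinct_card finite_lessThan)

lemma bfs_complete:
  "length (bfs chs r N) = N" "distinct (bfs chs r N)" "set (bfs chs r N) = {..<N}"
proof -
  note inv = bfs_invariant[of N, simplified]
  show len: "length (bfs chs r N) = N" using inv length_bfs_le[of N] by simp
  show d: "distinct (bfs chs r N)" using inv by blast
  show "set (bfs chs r N) = {..<N}"
    by (rule card_subset_eq) (use inv len distinct_card[OF d] in auto)
qed

text \<open>Some parent of \<open>j\<close> stands before it in the list; parents are unique and
  entries distinct, so that position is \<open>p\<close>. Read backwards, the list treats children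
  first.\<close>

lemma bfs_child_later:
  assumes "p < N" "j \<in> ch (bfs chs r N ! p)"
  shows "\<exists>q. p < q \<and> q < N \<and> bfs chs r N ! q = j"
proof -
  have "j \<in> set (bfs chs r N)" using assms child_in_nodes bfs_complete(3) by blast
  then obtain q where q: "q < N" "bfs chs r N ! q = j" using bfs_complete(1) by (metis in_set_conv_nth)
  have "j \<noteq> r" using assms root_no_parent by auto
  then have "0 < q" using q bfs_invariant[of N] by (cases q) auto
  then obtain p' where p': "p' < q" "j \<in> ch (bfs chs r N ! p')"
    using bfs_invariant[of N] q bfs_complete(1) by auto
  then have "bfs chs r N ! p' = bfs chs r N ! p" using assms parent_unique by blast
  then have "p' = p" using bfs_complete(1,2) assms p' q by (simp add: nth_eq_iff_index_eq)
  then show ?thesis using p' q by blast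
qed

end

definition order_prog :: com where
  "order_prog = Seq (Assign ''order'' (Const 0) (Var ''root'')) (Seq (Set ''tail'' (Const 1))
     (For ''h'' (Const 0) (Var ''nodes'') (Seq (Set ''i'' (Cell ''order'' (Var ''h'')))
        (For ''e'' (Cell ''child_start'' (Var ''i'')) (Cell ''child_start'' (Add (Var ''i'') (Const 1)))
          (Seq (Assign ''order'' (Var ''tail'') (Cell ''child'' (Var ''e'')))
               (Set ''tail'' (Add (Var ''tail'') (Const 1))))))))"

text \<open>At most two children per node make each round cost a constant, whence a total linear in
  \<open>N\<close>.\<close>

lemma (in tree_lists) wp_order_prog:
  assumes s: "s ''nodes'' 0 = int N" "s ''root'' 0 = int r"
    and st: "stored chs (s ''child_start'') (s ''child'')"
    and two: "\<And>i. i < N \<Longrightarrow> length (chs ! i) \<le> 2"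
  shows "wp order_prog s (\<lambda>c t. c \<le> 200 * N + 40 \<and>
     (\<forall>y. y \<notin> {''order'', ''tail'', ''h'', ''i'', ''e''} \<longrightarrow> t y = s y) \<and>
     (\<forall>q<N. t ''order'' (int q) = int (bfs chs r N ! q)))"
proof -
  define frame where "frame t \<longleftrightarrow>
    (\<forall>y. y \<notin> {''order'', ''tail'', ''h'', ''i'', ''e''} \<longrightarrow> t y = s y)" for t :: state
  define holds where "holds L t \<longleftrightarrow> t ''tail'' 0 = int (length L) \<and>
    (\<forall>q<length L. t ''order'' (int q) = int (L ! q))" for L and t :: state
  show ?thesis
    unfolding order_prog_def wp_simps
  proof (rule wp_For_uniform[where m = N and K = 120 and
      J = "\<lambda>h t. frame t \<and> t ''h'' 0 = int h \<and> holds (bfs chs r h) t"])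
    fix h t assume h: "h < N" and J: "frame t \<and> t ''h'' 0 = int h \<and> holds (bfs chs r h) t"
    define i where "i = bfs chs r h ! h"
    have hl: "h < length (bfs chs r h)" using bfs_invariant[of h] h by simp
    then have iN: "i < N" using bfs_invariant[of h] h nth_mem[OF hl] unfolding i_def by auto
    have ti: "t ''order'' (int h) = int i" using J hl unfolding holds_def i_def by auto
    have pos: "s ''child_start'' (int i + 1) = s ''child_start'' (int i) + int (length (chs ! i))"
      and elem: "\<And>q. q < length (chs ! i) \<Longrightarrow> s ''child'' (s ''child_start'' (int i) + int q) = int (chs ! i ! q)"
      using st iN chs_nth(2) unfolding stored_def by auto
    from J have t: "t ''child_start'' = s ''child_start''" "t ''child'' = s ''child''"
      unfolding frame_def by auto
    show "wp (Seq (Set ''i'' (Cell ''order'' (Var ''h'')))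
        (For ''e'' (Cell ''child_start'' (Var ''i'')) (Cell ''child_start'' (Add (Var ''i'') (Const 1)))
          (Seq (Assign ''order'' (Var ''tail'') (Cell ''child'' (Var ''e'')))
               (Set ''tail'' (Add (Var ''tail'') (Const 1)))))) t
       (\<lambda>l u. l \<le> 120 \<and> frame (u(''h'' := (u ''h'')(0 := u ''h'' 0 + 1))) \<and>
          (u(''h'' := (u ''h'')(0 := u ''h'' 0 + 1))) ''h'' 0 = int (Suc h) \<and>
          holds (bfs chs r (Suc h)) (u(''h'' := (u ''h'')(0 := u ''h'' 0 + 1))))"
      unfolding wp_simps
      by (rule wp_For_uniform[where m = "length (chs ! i)" and K = 15 and
          J = "\<lambda>q t'. (\<forall>y. y \<notin> {''order'', ''tail'', ''i'', ''e''} \<longrightarrow> t' y = t y) \<and> t' ''i'' 0 = int i \<and>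
            t' ''e'' 0 = s ''child_start'' (int i) + int q \<and>
            holds (bfs chs r h @ take q (chs ! i)) t'"])
        (use J t ti pos elem two[OF iN] in \<open>simp_all add: wp_simps frame_def holds_def
          take_Suc_conv_app_nth nth_append i_def[symmetric] less_Suc_eq\<close>)
  next
    fix l t assume "frame t \<and> t ''h'' 0 = int N \<and> holds (bfs chs r N) t"
      and l: "l \<le> N * (120 + acost (Var ''nodes'') + 10) + acost (Const 0) + acost (Var ''nodes'') + 6"
    then have "frame t" and "\<forall>q<N. t ''order'' (int q) = int (bfs chs r N ! q)"
      unfolding holds_def bfs_complete(1) by blast+
    moreover have "acost (Const 0) + acost (Var ''root'') + 1 + (acost (Const 0) + acost (Const 1) + 1 + l)
        \<le> 200 * N + 40" using l by simp
    ultimately show "acost (Const 0) + acost (Var ''root'') + 1 + (acost (Const 0) + acost (Const 1) + 1 + l)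
         \<le> 200 * N + 40 \<and>
        (\<forall>y. y \<notin> {''order'', ''tail'', ''h'', ''i'', ''e''} \<longrightarrow> t y = s y) \<and>
        (\<forall>q<N. t ''order'' (int q) = int (bfs chs r N ! q))"
      unfolding frame_def by blast
  qed (use s in \<open>simp_all add: frame_def holds_def\<close>)
qed

text \<open>Here \<open>e\<close> runs over absolute positions in the flat array, whence
  \<open>indep\<close>: the invariant must survive each change of \<open>e\<close>, while the body
  leaves its value alone. The 15 is the overhead \<open>acost b + 10\<close> of a round with this
  upper bound.\<close>

lemma wp_For_stored:
  assumes st: "stored xss (s p) (s a)" and i: "i < length xss" "s x 0 = int i" and e: "e \<notin> {p, a, x}"
    and init: "J 0 s"
    and frame: "\<And>k t. J k t \<Longrightarrow> t p = s p \<and> t a = s a \<and> t x 0 = s x 0"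
    and indep: "\<And>k t g. J k t \<Longrightarrow> J k (t(e := g))"
    and body: "\<And>k t. k < length (xss ! i) \<Longrightarrow> J k t \<Longrightarrow> t a (t e 0) = int (xss ! i ! k) \<Longrightarrow>
      wp c t (\<lambda>l u. l \<le> T k \<and> J (Suc k) u \<and> u e 0 = t e 0)"
    and post: "\<And>l t. J (length (xss ! i)) t \<Longrightarrow> l \<le> (\<Sum>k<length (xss ! i). T k + 15) + 20 \<Longrightarrow> Q l t"
  shows "wp (For e (Cell p (Var x)) (Cell p (Add (Var x) (Const 1))) c) s Q"
proof (rule wp_For[where m = "length (xss ! i)" and T = T and
      J = "\<lambda>k t. J k t \<and> t e 0 = s p (int i) + int k"], goal_cases)
  case 1
  then show ?case using init indep e i by simp
next
  case (2 k t)
  then show ?case using frame[of k t] e i st unfolding stored_def by (simp add: of_nat_diff)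
next
  case (3 k t)
  then have "t a (t e 0) = int (xss ! i ! k)"
    using frame[of k t] i st unfolding stored_def by simp
  with 3 show ?case by (intro wp_mono[OF body[of k t]]) (auto intro: indep)
next
  case (4 l t)
  then show ?case by (intro post) auto
qed

section \<open>Enumerating subsets and pairs of disjoint subsets\<close>

text \<open>The order is that of the array \<open>sub\<close>: with each bag vertex the list
  doubles, and its second half repeats the first with the vertex added.\<close>

definition subset_list :: "nat list \<Rightarrow> nat set list" where
  "subset_list xs = fold (\<lambda>v L. L @ map (insert v) L) xs [{}]"

lemma subset_list_snoc:
  "subset_list (xs @ [v]) = subset_list xs @ map (insert v) (subset_list xs)"
  unfolding subset_list_def by simp

lemma length_subset_list: "length (subset_list xs) = 2 ^ length xs"
  by (induction xs rule: rev_induct) (simp_all add: subset_list_snoc, simp add: subset_list_def)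

lemma set_subset_list: "set (subset_list xs) = Pow (set xs)"
proof (induction xs rule: rev_induct)
  case (snoc v xs)
  then show ?case by (simp add: subset_list_snoc Pow_insert)
qed (simp add: subset_list_def)

text \<open>Each vertex goes to neither set, to the first or to the second, so the list triples; the
  three blocks mirror the layout of \<open>pa\<close> and \<open>pb\<close>.\<close>

definition pair_list :: "nat list \<Rightarrow> (nat set \<times> nat set) list" where
  "pair_list xs = fold (\<lambda>v L. L @ map (apfst (insert v)) L @ map (apsnd (insert v)) L) xs [({}, {})]"

lemma pair_list_snoc:
  "pair_list (xs @ [v]) =
    pair_list xs @ map (apfst (insert v)) (pair_list xs) @ map (apsnd (insert v)) (pair_list xs)"
  unfolding pair_list_def by simp

lemma length_pair_list: "length (pair_list xs) = 3 ^ length xs"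
  by (induction xs rule: rev_induct) (simp_all add: pair_list_snoc, simp add: pair_list_def)

text \<open>Distinctness matters because a join adds a product into the table for each listed pair,
  so a repeated pair would be counted twice.\<close>

lemma pair_list_distinct_set:
  assumes "distinct xs"
  shows "distinct (pair_list xs) \<and> set (pair_list xs) = {(A, B). A \<union> B \<subseteq> set xs \<and> A \<inter> B = {}}"
  using assms
proof (induction xs rule: rev_induct)
  case Nil
  then show ?case by (auto simp: pair_list_def)
next
  case (snoc v xs)
  define D where "D = {(A, B). A \<union> B \<subseteq> set xs \<and> A \<inter> B = {}}"
  have IH: "distinct (pair_list xs)" "set (pair_list xs) = D" and v: "v \<notin> set xs"
    using snoc unfolding D_def by auto
  have notin: "v \<notin> A" "v \<notin> B" if "(A, B) \<in> D" for A B using that v unfolding D_def by auto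
  have "inj_on (apfst (insert v)) D" "inj_on (apsnd (insert v)) D"
    by (rule inj_onI; clarsimp; metis notin insert_ident)+
  moreover have "D \<inter> apfst (insert v) ` D = {}" "D \<inter> apsnd (insert v) ` D = {}"
    "apfst (insert v) ` D \<inter> apsnd (insert v) ` D = {}"
    using notin by fastforce+
  ultimately have "distinct (pair_list (xs @ [v]))"
    using IH by (auto simp: pair_list_snoc distinct_map)
  moreover have "set (pair_list (xs @ [v])) = {(A, B). A \<union> B \<subseteq> set (xs @ [v]) \<and> A \<inter> B = {}}"
  proof (intro equalityI subsetI)
    fix p assume "p \<in> set (pair_list (xs @ [v]))"
    then consider "p \<in> D" | "p \<in> apfst (insert v) ` D" | "p \<in> apsnd (insert v) ` D"
      using IH by (auto simp: pair_list_snoc)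
    then show "p \<in> {(A, B). A \<union> B \<subseteq> set (xs @ [v]) \<and> A \<inter> B = {}}"
      by cases (use v in \<open>auto simp: D_def\<close>)
  next
    fix p assume "p \<in> {(A, B). A \<union> B \<subseteq> set (xs @ [v]) \<and> A \<inter> B = {}}"
    then obtain A B where p: "p = (A, B)" "A \<union> B \<subseteq> insert v (set xs)" "A \<inter> B = {}" by auto
    consider "v \<notin> A" "v \<notin> B" | "v \<in> A" | "v \<in> B" by blast
    then show "p \<in> set (pair_list (xs @ [v]))"
    proof cases
      case 1
      then have "p \<in> D" using p unfolding D_def by auto
      then show ?thesis using IH by (simp add: pair_list_snoc)
    next
      case 2
      then have "(A - {v}, B) \<in> D" "p = apfst (insert v) (A - {v}, B)"
        using p unfolding D_def by auto
      then have "p \<in> apfst (insert v) ` D" by (metis image_eqI)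
      then show ?thesis using IH by (simp add: pair_list_snoc)
    next
      case 3
      then have "(A, B - {v}) \<in> D" "p = apsnd (insert v) (A, B - {v})"
        using p unfolding D_def by auto
      then have "p \<in> apsnd (insert v) ` D" by (metis image_eqI)
      then show ?thesis using IH by (simp add: pair_list_snoc)
    qed
  qed
  ultimately show ?case by blast
qed

section \<open>Coding vertex sets by integers\<close>

definition enc :: "nat set \<Rightarrow> int" where "enc A = int (set_encode A)"

lemma enc_empty [simp]: "enc {} = 0" unfolding enc_def by simp

lemma enc_insert: "finite A \<Longrightarrow> v \<notin> A \<Longrightarrow> enc (insert v A) = enc A + 2 ^ v"
  unfolding enc_def by simp

lemma enc_remove: "finite A \<Longrightarrow> v \<in> A \<Longrightarrow> enc (A - {v}) = enc A - 2 ^ v"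
  using enc_insert[of "A - {v}" v] by (simp add: insert_absorb)

lemma enc_Un: "finite A \<Longrightarrow> finite B \<Longrightarrow> A \<inter> B = {} \<Longrightarrow> enc (A \<union> B) = enc A + enc B"
  unfolding enc_def set_encode_def by (simp add: sum.union_disjoint)

text \<open>Infinite sets all receive the code 0 of the empty set, hence the finiteness of both
  sides.\<close>

lemma enc_inject: "finite A \<Longrightarrow> finite B \<Longrightarrow> enc A = enc B \<longleftrightarrow> A = B"
  unfolding enc_def by (simp add: set_encode_eq)

text \<open>The machine divides but has no remainder; the left side is the remainder modulo 2 as a
  program can compute it.\<close>

lemma enc_bit:
  assumes "finite A"
  shows "enc A div 2 ^ v - 2 * (enc A div 2 ^ v div 2) = of_bool (v \<in> A)"
proof -
  have "v \<in> A \<longleftrightarrow> odd (set_encode A div 2 ^ v)"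
    using set_encode_inverse[OF assms] unfolding set_decode_def by auto
  also have "\<dots> \<longleftrightarrow> odd (enc A div 2 ^ v)"
    unfolding enc_def by (metis even_of_nat of_nat_numeral of_nat_power zdiv_int)
  finally have "enc A div 2 ^ v mod 2 = of_bool (v \<in> A)" by (auto simp: odd_iff_mod_2_eq_one)
  then show ?thesis by (simp add: minus_mult_div_eq_mod)
qed

text \<open>The multiplier \<open>m\<close> may be negative, since a forget step can read at a
  negative code; \<open>div\<close> rounds down, so the quotient still recovers
  \<open>m\<close>.\<close>

lemma index_inject:
  fixes m m' :: int
  assumes "i < N" "i' < N"
  shows "m * int N + int i = m' * int N + int i' \<longleftrightarrow> m = m' \<and> i = i'"
proof
  assume eq: "m * int N + int i = m' * int N + int i'"
  have "(m * int N + int i) div int N = m" "(m' * int N + int i') div int N = m'"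
    using assms by (simp_all add: div_add1_eq)
  then show "m = m' \<and> i = i'" using eq by auto
qed simp

definition subsets_prog :: com where
  "subsets_prog = Seq (Assign ''sub'' (Const 0) (Const 0)) (Seq (Set ''cnt'' (Const 1))
     (For ''e'' (Cell ''bag_start'' (Var ''i'')) (Cell ''bag_start'' (Add (Var ''i'') (Const 1)))
       (Seq
         (For ''t'' (Const 0) (Var ''cnt'')
           (Assign ''sub'' (Add (Var ''cnt'') (Var ''t''))
             (Add (Cell ''sub'' (Var ''t'')) (Cell ''pow'' (Cell ''bag'' (Var ''e''))))))
         (Set ''cnt'' (Mul (Const 2) (Var ''cnt''))))))"

definition pairs_prog :: com where
  "pairs_prog = Seq (Assign ''pa'' (Const 0) (Const 0)) (Seq (Assign ''pb'' (Const 0) (Const 0))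
     (Seq (Set ''cnt'' (Const 1))
       (For ''e'' (Cell ''bag_start'' (Var ''i'')) (Cell ''bag_start'' (Add (Var ''i'') (Const 1)))
         (Seq
           (For ''t'' (Const 0) (Var ''cnt'')
             (Seq
               (Seq
                 (Assign ''pa'' (Add (Var ''cnt'') (Var ''t''))
                   (Add (Cell ''pa'' (Var ''t'')) (Cell ''pow'' (Cell ''bag'' (Var ''e'')))))
                 (Assign ''pb'' (Add (Var ''cnt'') (Var ''t'')) (Cell ''pb'' (Var ''t''))))
               (Seq
                 (Assign ''pa'' (Add (Mul (Const 2) (Var ''cnt'')) (Var ''t'')) (Cell ''pa'' (Var ''t'')))
                 (Assign ''pb'' (Add (Mul (Const 2) (Var ''cnt'')) (Var ''t''))
                   (Add (Cell ''pb'' (Var ''t'')) (Cell ''pow'' (Cell ''bag'' (Var ''e''))))))))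
           (Set ''cnt'' (Mul (Const 3) (Var ''cnt'')))))))"

section \<open>Processing a single node\<close>

text \<open>Leaf, introduce and forget nodes differ only in the command \<open>c\<close>, which
  leaves the value for the current subset in \<open>acc\<close>.\<close>

definition row_prog :: "com \<Rightarrow> com" where
  "row_prog c = Seq subsets_prog (For ''t'' (Const 0) (Var ''cnt'')
     (Seq c (Assign ''tab'' (Add (Mul (Cell ''sub'' (Var ''t'')) (Var ''nodes'')) (Var ''i''))
       (Var ''acc''))))"

definition introduce_prog :: com where
  "introduce_prog = row_prog
     (Set ''acc'' (Cell ''tab'' (Add (Mul (Cell ''sub'' (Var ''t'')) (Var ''nodes'')) (Var ''j''))))"

text \<open>The factor \<open>q - 2 * (q div 2)\<close> is the bit of the current subset at \<open>u\<close>; if it is \<open>0\<close>, it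
  cancels the meaningless table entry read at the code minus \<open>2 ^ u\<close>.\<close>

definition forget_step :: com where
  "forget_step = Seq
     (Set ''acc'' (Cell ''tab'' (Add (Mul (Add (Cell ''sub'' (Var ''t'')) (Cell ''pow'' (Var ''v'')))
        (Var ''nodes'')) (Var ''j''))))
     (For ''e'' (Cell ''bag_start'' (Var ''i'')) (Cell ''bag_start'' (Add (Var ''i'') (Const 1)))
       (Seq (Set ''q'' (Div (Cell ''sub'' (Var ''t'')) (Cell ''pow'' (Cell ''bag'' (Var ''e'')))))
         (Set ''acc'' (Add (Var ''acc'') (Mul
           (Mul (Cell ''mat'' (Add (Mul (Cell ''bag'' (Var ''e'')) (Var ''n'')) (Var ''v'')))
             (Sub (Var ''q'') (Mul (Const 2) (Div (Var ''q'') (Const 2)))))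
           (Cell ''tab'' (Add (Mul
             (Sub (Cell ''sub'' (Var ''t'')) (Cell ''pow'' (Cell ''bag'' (Var ''e''))))
             (Var ''nodes'')) (Var ''j'')))))) ))"

text \<open>The forgotten vertex is the sum of the vertices in the child's bag minus the sum of those in
  the bag of the node itself.\<close>

definition forget_prog :: com where
  "forget_prog = Seq (Set ''v'' (Const 0)) (Seq
     (For ''e'' (Cell ''bag_start'' (Var ''j'')) (Cell ''bag_start'' (Add (Var ''j'') (Const 1)))
       (Set ''v'' (Add (Var ''v'') (Cell ''bag'' (Var ''e''))))) (Seq
     (For ''e'' (Cell ''bag_start'' (Var ''i'')) (Cell ''bag_start'' (Add (Var ''i'') (Const 1)))
       (Set ''v'' (Sub (Var ''v'') (Cell ''bag'' (Var ''e'')))))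
     (row_prog forget_step)))"

text \<open>The pairs range over all unions at once, and each product is added to the cell of its
  union, whose code is the sum of the two codes. The sums start from untouched cells, hence from
  0.\<close>

definition join_prog :: com where
  "join_prog = Seq pairs_prog (For ''t'' (Const 0) (Var ''cnt'')
     (Seq (Set ''q'' (Add (Mul (Add (Cell ''pa'' (Var ''t'')) (Cell ''pb'' (Var ''t''))) (Var ''nodes'')) (Var ''i'')))
       (Assign ''tab'' (Var ''q'') (Add (Cell ''tab'' (Var ''q'')) (Mul
         (Cell ''tab'' (Add (Mul (Cell ''pa'' (Var ''t'')) (Var ''nodes'')) (Var ''j'')))
         (Cell ''tab'' (Add (Mul (Cell ''pb'' (Var ''t'')) (Var ''nodes'')) (Var ''k''))))))))"

section \<open>Correctness and cost of the node programs\<close>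

locale dp_input = nice_decomposition "{..<N}" F r "{..<n}" E X + tree_lists N F r chs
  for N n :: nat and F and r :: nat and E X chs +
  fixes bags :: "nat list list"
  assumes bags: "lists_represent N X bags"
begin

lemma bags_nth:
  "i < N \<Longrightarrow> distinct (bags ! i)" "i < N \<Longrightarrow> set (bags ! i) = X i" "length bags = N"
  using bags unfolding lists_represent_def by auto

lemma length_bag: "i < N \<Longrightarrow> length (bags ! i) = card (X i)"
  using bags_nth distinct_card by metis

lemma bag_less: "i < N \<Longrightarrow> u \<in> X i \<Longrightarrow> u < n"
  using bag_subset[of i] by auto

definition ready :: "state \<Rightarrow> bool" where
  "ready s \<longleftrightarrow> s ''n'' 0 = int n \<and> s ''nodes'' 0 = int N \<and>
     stored chs (s ''child_start'') (s ''child'') \<and> stored bags (s ''bag_start'') (s ''bag'') \<and>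
     (\<forall>v\<le>n. s ''pow'' (int v) = 2 ^ v) \<and>
     (\<forall>v<n. \<forall>u<n. s ''mat'' (int v * int n + int u) = of_bool ({v, u} \<in> E))"

lemma wp_subsets_prog:
  assumes s: "ready s" and i: "i < N" "s ''i'' 0 = int i"
  shows "wp subsets_prog s (\<lambda>l t. l \<le> 150 * 2 ^ card (X i) \<and>
    (\<forall>y. y \<notin> {''sub'', ''cnt'', ''e'', ''t''} \<longrightarrow> t y = s y) \<and>
    t ''cnt'' 0 = int (2 ^ card (X i)) \<and>
    (\<forall>m<2 ^ card (X i). t ''sub'' (int m) = enc (subset_list (bags ! i) ! m)))"
proof -
  define xs where "xs = bags ! i"
  have len: "length xs = card (X i)" using length_bag[OF i(1)] unfolding xs_def .
  define ok where "ok q t \<longleftrightarrow> (\<forall>y. y \<notin> {''sub'', ''cnt'', ''e'', ''t''} \<longrightarrow> t y = s y) \<and>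
    t ''cnt'' 0 = int (2 ^ q) \<and> (\<forall>m<2 ^ q. t ''sub'' (int m) = enc (subset_list (take q xs) ! m))"
    for q and t :: state
  show ?thesis
    unfolding subsets_prog_def wp_simps
  proof (rule wp_For_stored[where xss = bags and a = "''bag''" and i = i and J = ok and T = "\<lambda>q. 40 * 2 ^ q + 20"], goal_cases)
    case 1
    then show ?case using s unfolding ready_def by simp
  next
    case 5
    then show ?case unfolding ok_def subset_list_def by simp
  next
    case (8 q t)
    define c where "c = (2::nat) ^ q"
    define v where "v = xs ! q"
    define L where "L = subset_list (take q xs)"
    define L' where "L' = subset_list (take (Suc q) xs)"
    have q: "q < length xs" using 8(1) unfolding xs_def .
    have v: "t ''bag'' (t ''e'' 0) = int v" using 8(3) unfolding v_def xs_def .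
    have "v \<in> set xs" using q unfolding v_def by simp
    then have "v \<le> n" using bags_nth(2)[OF i(1)] bag_less[OF i(1)] unfolding xs_def by (simp add: less_imp_le)
    moreover have "t ''pow'' = s ''pow''" using 8(2) unfolding ok_def by simp
    ultimately have pow: "t ''pow'' (int v) = 2 ^ v" using s unfolding ready_def by simp
    have take: "take (Suc q) xs = take q xs @ [v]" using q unfolding v_def by (simp add: take_Suc_conv_app_nth)
    have L': "L' = L @ map (insert v) L" unfolding L'_def L_def take by (rule subset_list_snoc)
    have lenL: "length L = c" unfolding L_def c_def using q by (simp add: length_subset_list)
    \<comment> \<open>\<open>v\<close> is missing from the first \<open>q\<close> entries of the
      bag, so inserting it adds its bit to the code.\<close>
    have new: "enc (L' ! (c + m)) = enc (L' ! m) + 2 ^ v" if "m < c" for m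
    proof -
      have "L ! m \<in> set L" using that lenL by simp
      then have "L ! m \<subseteq> set (take q xs)" unfolding L_def set_subset_list by blast
      moreover have "v \<notin> set (take q xs)"
        using bags_nth(1)[OF i(1)] q unfolding v_def xs_def
        by (auto simp: in_set_conv_nth nth_eq_iff_index_eq)
      ultimately have "enc (insert v (L ! m)) = enc (L ! m) + 2 ^ v"
        by (intro enc_insert) (auto intro: finite_subset)
      then show ?thesis using that lenL unfolding L' by (simp add: nth_append)
    qed
    have old: "L' ! m = L ! m" if "m < c" for m using that lenL unfolding L' by (simp add: nth_append)
    have tc: "t ''cnt'' 0 = int c" and ts: "\<And>m. m < c \<Longrightarrow> t ''sub'' (int m) = enc (L' ! m)"
      using 8(2) old unfolding ok_def c_def L_def by simp_all
    show ?case
      unfolding wp_simps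
    proof (rule wp_For_uniform[where m = c and K = 18 and J = "\<lambda>k t'.
          (\<forall>y. y \<notin> {''sub'', ''t''} \<longrightarrow> t' y = t y) \<and> t' ''t'' 0 = int k \<and>
          (\<forall>m<c + k. t' ''sub'' (int m) = enc (L' ! m))"], goal_cases)
      case 1
      then show ?case using ts by simp
    next
      case (2 k t')
      then show ?case using tc by simp
    next
      case (3 k t')
      then show ?case using tc v pow new[of k]
        by (simp add: wp_simps less_Suc_eq)
    next
      case (4 l t')
      have "2 ^ Suc q = c + c" unfolding c_def by simp
      with 4 show ?case using tc 8(2) unfolding ok_def L'_def[symmetric] c_def[symmetric]
        by simp
    qed
  next
    case (9 l t)
    \<comment> \<open>Geometric growth keeps the total proportional to the last round; the additive
      35 of a round is at most \<open>35 * 2 ^ k\<close>.\<close>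
    have "(\<Sum>q<k. 40 * 2 ^ q + 20 + 15) \<le> 75 * 2 ^ k - (75::nat)" for k
    proof (induction k)
      case (Suc k)
      have "1 \<le> (2::nat) ^ k" by simp
      with Suc show ?case unfolding sum.lessThan_Suc power_Suc by linarith
    qed simp
    from this[of "length (bags ! i)"] have "(\<Sum>q<length (bags ! i). 40 * 2 ^ q + 20 + 15) \<le> 75 * (2::nat) ^ card (X i) - 75"
      using len unfolding xs_def by simp
    moreover have "1 \<le> (2::nat) ^ card (X i)" by simp
    ultimately have "l + 10 \<le> 150 * 2 ^ card (X i)" using 9(2) by linarith
    then show ?case using 9(1) len unfolding ok_def xs_def by simp
  qed (use i s bags_nth(3) in \<open>simp_all add: ok_def\<close>)
qed

lemma wp_pairs_prog:
  assumes s: "ready s" and i: "i < N" "s ''i'' 0 = int i"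
  shows "wp pairs_prog s (\<lambda>l t. l \<le> 200 * 3 ^ card (X i) \<and>
    (\<forall>y. y \<notin> {''pa'', ''pb'', ''cnt'', ''e'', ''t''} \<longrightarrow> t y = s y) \<and>
    t ''cnt'' 0 = int (3 ^ card (X i)) \<and>
    (\<forall>m<3 ^ card (X i). t ''pa'' (int m) = enc (fst (pair_list (bags ! i) ! m)) \<and>
      t ''pb'' (int m) = enc (snd (pair_list (bags ! i) ! m))))"
proof -
  define xs where "xs = bags ! i"
  have len: "length xs = card (X i)" using length_bag[OF i(1)] unfolding xs_def .
  have dist: "distinct xs" using bags_nth(1)[OF i(1)] unfolding xs_def .
  define ok where "ok q t \<longleftrightarrow> (\<forall>y. y \<notin> {''pa'', ''pb'', ''cnt'', ''e'', ''t''} \<longrightarrow> t y = s y) \<and>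
    t ''cnt'' 0 = int (3 ^ q) \<and>
    (\<forall>m<3 ^ q. t ''pa'' (int m) = enc (fst (pair_list (take q xs) ! m)) \<and>
      t ''pb'' (int m) = enc (snd (pair_list (take q xs) ! m)))"
    for q and t :: state
  show ?thesis
    unfolding pairs_prog_def wp_simps
  proof (rule wp_For_stored[where xss = bags and a = "''bag''" and i = i and J = ok and T = "\<lambda>q. 80 * 3 ^ q + 20"], goal_cases)
    case 1
    then show ?case using s unfolding ready_def by simp
  next
    case 5
    then show ?case unfolding ok_def pair_list_def by simp
  next
    case (8 q t)
    define c where "c = (3::nat) ^ q"
    define v where "v = xs ! q"
    define L where "L = pair_list (take q xs)"
    define L' where "L' = pair_list (take (Suc q) xs)"
    have q: "q < length xs" using 8(1) unfolding xs_def .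
    have v: "t ''bag'' (t ''e'' 0) = int v" using 8(3) unfolding v_def xs_def .
    have "v \<in> set xs" using q unfolding v_def by simp
    then have "v \<le> n" using bags_nth(2)[OF i(1)] bag_less[OF i(1)] unfolding xs_def by (simp add: less_imp_le)
    moreover have "t ''pow'' = s ''pow''" using 8(2) unfolding ok_def by simp
    ultimately have pow: "t ''pow'' (int v) = 2 ^ v" using s unfolding ready_def by simp
    have take: "take (Suc q) xs = take q xs @ [v]" using q unfolding v_def by (simp add: take_Suc_conv_app_nth)
    have L': "L' = L @ map (apfst (insert v)) L @ map (apsnd (insert v)) L"
      unfolding L'_def L_def take by (rule pair_list_snoc)
    have lenL: "length L = c" unfolding L_def c_def using q by (simp add: length_pair_list)
    have fresh: "finite (fst (L ! m)) \<and> finite (snd (L ! m)) \<and> v \<notin> fst (L ! m) \<and> v \<notin> snd (L ! m)"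
      if "m < c" for m
    proof -
      have "L ! m \<in> set L" using that lenL by simp
      then have "fst (L ! m) \<union> snd (L ! m) \<subseteq> set (take q xs)"
        unfolding L_def using pair_list_distinct_set[of "take q xs"] dist by (auto simp: case_prod_beta)
      moreover have "v \<notin> set (take q xs)"
        using dist q unfolding v_def by (auto simp: in_set_conv_nth nth_eq_iff_index_eq)
      ultimately show ?thesis by (auto intro: finite_subset)
    qed
    have new: "enc (fst (L' ! (c + m))) = enc (fst (L' ! m)) + 2 ^ v"
      "enc (snd (L' ! (c + m))) = enc (snd (L' ! m))"
      "enc (fst (L' ! (2 * c + m))) = enc (fst (L' ! m))"
      "enc (snd (L' ! (2 * c + m))) = enc (snd (L' ! m)) + 2 ^ v" if "m < c" for m
      using that lenL fresh[OF that] unfolding L' by (simp_all add: nth_append enc_insert)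
    have old: "L' ! m = L ! m" if "m < c" for m using that lenL unfolding L' by (simp add: nth_append)
    have tc: "t ''cnt'' 0 = int c" and ts: "\<And>m. m < c \<Longrightarrow> t ''pa'' (int m) = enc (fst (L' ! m))"
        "\<And>m. m < c \<Longrightarrow> t ''pb'' (int m) = enc (snd (L' ! m))"
      using 8(2) old unfolding ok_def c_def L_def by simp_all
    show ?case
      unfolding wp_Seq[of "For _ _ _ _"] wp_Assign
    \<comment> \<open>Three blocks of length \<open>c\<close>: the first is old, the other two are
      filled side by side, hold \<open>k\<close> new entries each and are complete when
      \<open>k = c\<close>.\<close>
    proof (rule wp_For_uniform[where m = c and K = 60 and J = "\<lambda>k t'.
          (\<forall>y. y \<notin> {''pa'', ''pb'', ''t''} \<longrightarrow> t' y = t y) \<and> t' ''t'' 0 = int k \<and>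
          (\<forall>m. m < c \<or> c \<le> m \<and> m < c + k \<or> 2 * c \<le> m \<and> m < 2 * c + k \<longrightarrow>
            t' ''pa'' (int m) = enc (fst (L' ! m)) \<and> t' ''pb'' (int m) = enc (snd (L' ! m)))"],
          goal_cases)
      case 1
      have "m < c \<or> c \<le> m \<and> m < c + 0 \<or> 2 * c \<le> m \<and> m < 2 * c + 0 \<longleftrightarrow> m < c" for m by auto
      then show ?case using ts by simp
    next
      case (2 k t')
      then show ?case using tc by simp
    next
      case (3 k t')
      have [simp]: "int m = int c + int k \<longleftrightarrow> m = c + k" "int m = 2 * int c + int k \<longleftrightarrow> m = 2 * c + k" for m
        by linarith+
      show ?case using 3 tc v pow
        by (simp add: wp_simps) (use new[OF 3(1)] in simp)
    next
      case (4 l t')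
      have "3 ^ Suc q = 3 * c" unfolding c_def by simp
      moreover have "\<forall>m<3 * c. t' ''pa'' (int m) = enc (fst (L' ! m)) \<and> t' ''pb'' (int m) = enc (snd (L' ! m))"
      proof (intro allI impI)
        fix m assume "m < 3 * c"
        then have "m < c \<or> c \<le> m \<and> m < c + c \<or> 2 * c \<le> m \<and> m < 2 * c + c" by linarith
        then show "t' ''pa'' (int m) = enc (fst (L' ! m)) \<and> t' ''pb'' (int m) = enc (snd (L' ! m))"
          using 4(1) by blast
      qed
      ultimately show ?case using 4 tc 8(2) unfolding ok_def L'_def[symmetric] c_def[symmetric]
        by simp
    qed
  next
    case (9 l t)
    have "(\<Sum>q<k. 80 * 3 ^ q + 20 + 15) \<le> 75 * 3 ^ k - (75::nat)" for k
    proof (induction k)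
      case (Suc k)
      have "1 \<le> (3::nat) ^ k" by simp
      with Suc show ?case unfolding sum.lessThan_Suc power_Suc by linarith
    qed simp
    from this[of "length (bags ! i)"] have "(\<Sum>q<length (bags ! i). 80 * 3 ^ q + 20 + 15) \<le> 75 * (3::nat) ^ card (X i) - 75"
      using len unfolding xs_def by simp
    moreover have "1 \<le> (3::nat) ^ card (X i)" by simp
    ultimately have "l + 10 \<le> 200 * 3 ^ card (X i)" using 9(2) by linarith
    then show ?case using 9(1) len unfolding ok_def xs_def by simp
  qed (use i s bags_nth(3) in \<open>simp_all add: ok_def\<close>)
qed


text \<open>All finite \<open>S\<close> are covered, not only subsets of the bag, since an introduce
  node reads its child's row at sets containing the new vertex.\<close>

definition row_ok :: "state \<Rightarrow> nat \<Rightarrow> bool" where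
  "row_ok t i \<longleftrightarrow> (\<forall>S. finite S \<longrightarrow> t ''tab'' (enc S * int N + int i) = int (count i S))"

text \<open>Row \<open>i\<close> occupies the residue class of \<open>i\<close> modulo
  \<open>N\<close>, so writing one row leaves all others intact.\<close>

definition same_rows :: "nat set \<Rightarrow> state \<Rightarrow> state \<Rightarrow> bool" where
  "same_rows A s t \<longleftrightarrow> (\<forall>m. \<forall>i\<in>A. t ''tab'' (m * int N + int i) = s ''tab'' (m * int N + int i))"

lemma row_ok_cong: "same_rows A s t \<Longrightarrow> i \<in> A \<Longrightarrow> row_ok s i \<Longrightarrow> row_ok t i"
  unfolding same_rows_def row_ok_def by simp

lemma same_rows_write:
  assumes "same_rows ({..<N} - {i}) s t" "i < N" "t' ''tab'' = (t ''tab'')(m * int N + int i := x)"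
  shows "same_rows ({..<N} - {i}) s t'"
  using assms index_inject[of _ N i] unfolding same_rows_def by simp

text \<open>While row \<open>i\<close> is being filled, all other rows stay as they were in
  \<open>s\<close>; thus \<open>c\<close> may rely on the finished row of a child at every subset.
  The 200 covers the enumeration and the loop overhead per subset.\<close>

lemma wp_row_prog:
  assumes s: "ready s" and i: "i < N" "s ''i'' 0 = int i"
    and zero: "\<And>m. s ''tab'' (m * int N + int i) = 0"
    and c: "\<And>t S. (\<forall>y. y \<notin> {''sub'', ''cnt'', ''e'', ''t'', ''acc'', ''q'', ''tab''} \<longrightarrow> t y = s y) \<Longrightarrow>
      same_rows ({..<N} - {i}) s t \<Longrightarrow> S \<subseteq> X i \<Longrightarrow> t ''sub'' (t ''t'' 0) = enc S \<Longrightarrow>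
      wp c t (\<lambda>l u. l \<le> K \<and> (\<forall>y. y \<notin> {''acc'', ''e'', ''q''} \<longrightarrow> u y = t y) \<and> u ''acc'' 0 = int (count i S))"
  shows "wp (row_prog c) s (\<lambda>l t. l \<le> (K + 200) * 2 ^ card (X i) \<and>
    (\<forall>y. y \<notin> {''sub'', ''cnt'', ''e'', ''t'', ''acc'', ''q'', ''tab''} \<longrightarrow> t y = s y) \<and>
    same_rows ({..<N} - {i}) s t \<and> row_ok t i)"
  unfolding row_prog_def wp_Seq
proof (rule wp_mono[OF wp_subsets_prog[OF s i]], goal_cases)
  case (1 l1 t1)
  define L where "L = subset_list (bags ! i)"
  define M where "M = (2::nat) ^ card (X i)"
  have lenL: "length L = M"
    unfolding L_def M_def by (simp add: length_subset_list length_bag[OF i(1)])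
  have setL: "set L = Pow (X i)" unfolding L_def by (simp add: set_subset_list bags_nth(2)[OF i(1)])
  have l1: "l1 \<le> 150 * M" and t1: "\<forall>y. y \<notin> {''sub'', ''cnt'', ''e'', ''t''} \<longrightarrow> t1 y = s y"
    "t1 ''cnt'' 0 = int M" "\<forall>m<M. t1 ''sub'' (int m) = enc (L ! m)"
    using 1 unfolding L_def M_def by blast+
  show ?case
  proof (rule wp_For_uniform[where m = M and K = "K + 12" and J = "\<lambda>k t.
      (\<forall>y. y \<notin> {''sub'', ''cnt'', ''e'', ''t'', ''acc'', ''q'', ''tab''} \<longrightarrow> t y = s y) \<and>
      t ''t'' 0 = int k \<and> t ''cnt'' 0 = int M \<and> t ''sub'' = t1 ''sub'' \<and>
      same_rows ({..<N} - {i}) s t \<and> (\<forall>S. finite S \<longrightarrow> t ''tab'' (enc S * int N + int i) =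
        (if S \<in> set (take k L) then int (count i S) else 0))"], goal_cases)
    case 1
    then show ?case using t1 zero unfolding same_rows_def by simp
  next
    case (2 k t)
    then show ?case by simp
  next
    case (3 k t)
    define S where "S = L ! k"
    have "S \<in> set L" using 3(1) lenL unfolding S_def by simp
    then have S: "S \<subseteq> X i" unfolding setL by blast
    have finS: "finite S" using S finite_bag[of i] i(1) by (auto intro: finite_subset)
    have sub: "t ''sub'' (t ''t'' 0) = enc S" using 3 t1(3) unfolding S_def by simp
    have frame: "\<forall>y. y \<notin> {''sub'', ''cnt'', ''e'', ''t'', ''acc'', ''q'', ''tab''} \<longrightarrow> t y = s y"
      and rows: "same_rows ({..<N} - {i}) s t" using 3(2) by blast+
    have take: "set (take (Suc k) L) = insert S (set (take k L))"
      using 3(1) lenL unfolding S_def by (simp add: take_Suc_conv_app_nth)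
    show ?case unfolding wp_Seq
    proof (rule wp_mono[OF c[OF frame rows S sub]], goal_cases)
      case u: (1 l u)
      define u' where "u' = u(''tab'' := (u ''tab'')(enc S * int N + int i := int (count i S)))"
      have ready: "u ''nodes'' 0 = int N" "u ''i'' 0 = int i"
        using u frame s i(2) unfolding ready_def by simp_all
      have rows_u: "same_rows ({..<N} - {i}) s u" using rows u unfolding same_rows_def by simp
      have rows': "same_rows ({..<N} - {i}) s u'"
        by (rule same_rows_write[OF rows_u i(1)]) (simp add: u'_def)
      have row': "u' ''tab'' (enc S' * int N + int i) =
          (if S' \<in> set (take (Suc k) L) then int (count i S') else 0)" if "finite S'" for S'
        using that 3(2) u i(1) enc_inject[OF that finS] index_inject[OF i(1) i(1)] unfolding take u'_def by simp
      have step: "u' = u(''tab'' := (u ''tab'')(aval (Add (Mul (Cell ''sub'' (Var ''t'')) (Var ''nodes''))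
          (Var ''i'')) u := aval (Var ''acc'') u))"
        using u ready sub unfolding u'_def by simp
      have "same_rows ({..<N} - {i}) s (u'(''t'' := g))" for g
        using rows' unfolding same_rows_def by simp
      moreover have "\<forall>y. y \<notin> {''sub'', ''cnt'', ''e'', ''t'', ''acc'', ''q'', ''tab''} \<longrightarrow> u' y = s y"
        using u frame unfolding u'_def by simp
      moreover have "u' ''t'' 0 = int k" "u' ''cnt'' 0 = int M" "u' ''sub'' = t1 ''sub''"
        using u 3(2) unfolding u'_def by simp_all
      ultimately show ?case
        unfolding wp_Assign step[symmetric] using u row' by simp
    qed
  next
    case (4 l t)
    \<comment> \<open>Sets outside the bag are never written, so their cells keep the 0 given by
      \<open>zero\<close>.\<close>
    have "count i S = 0" if "S \<notin> Pow (X i)" for S using that unfolding count_def by simp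
    then have "row_ok t i" unfolding row_ok_def using 4(1) lenL setL by simp
    moreover have "l1 + l \<le> (K + 200) * M"
    proof -
      have "1 \<le> M" unfolding M_def by simp
      moreover have "l \<le> M * (K + 24) + 9" using 4(2) by (simp add: algebra_simps)
      ultimately show ?thesis using l1 by (simp add: algebra_simps)
    qed
    ultimately show ?case using 4(1) unfolding M_def by blast
  qed
qed

lemma wp_forget_step:
  assumes t: "ready t" and i: "i < N" "t ''i'' 0 = int i" and j: "ch i = {j}" "t ''j'' 0 = int j" "row_ok t j"
    and v: "v \<notin> X i" "X j = insert v (X i)" "t ''v'' 0 = int v"
    and S: "S \<subseteq> X i" "t ''sub'' (t ''t'' 0) = enc S"
  shows "wp forget_step t (\<lambda>l u. l \<le> 75 * card (X i) + 60 \<and>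
    (\<forall>y. y \<notin> {''acc'', ''e'', ''q''} \<longrightarrow> u y = t y) \<and> u ''acc'' 0 = int (count i S))"
proof -
  define xs where "xs = bags ! i"
  have len: "length xs = card (X i)" using length_bag[OF i(1)] unfolding xs_def .
  have dist: "distinct xs" "set xs = X i" using bags_nth(1,2)[OF i(1)] unfolding xs_def by simp_all
  have finS: "finite S" using S(1) finite_bag[of i] i(1) by (auto intro: finite_subset)
  have "v \<notin> S" using v S by blast
  have jN: "j < N" using j(1) child_in_nodes[of j i] by simp
  have vn: "v < n" using bag_less[OF jN, of v] v by simp
  have nodes: "t ''nodes'' 0 = int N" "t ''n'' 0 = int n" using t unfolding ready_def by simp_all
  have pow: "t ''pow'' (int u) = 2 ^ u" if "u < n" for u using t that unfolding ready_def by simp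
  have mat: "t ''mat'' (int u * int n + int u') = of_bool ({u, u'} \<in> E)" if "u < n" "u' < n" for u u'
    using t that unfolding ready_def by simp
  have row: "t ''tab'' (enc S' * int N + int j) = int (count j S')" if "finite S'" for S'
    using j(3) that unfolding row_ok_def by simp
  \<comment> \<open>Both conditions on \<open>u\<close> appear as factors, so the loop can run over
    the whole bag without branching.\<close>
  define f where "f u = (of_bool ({u, v} \<in> E) * of_bool (u \<in> S) * int (count j (S - {u})))" for u
  define first where "first = int (count j (insert v S))"
  have init: "t ''tab'' ((enc S + 2 ^ v) * int N + int j) = first"
    using row[of "insert v S"] finS \<open>v \<notin> S\<close> enc_insert[of S v] unfolding first_def by simp
  show ?thesis
    unfolding forget_step_def wp_Seq wp_Assign
  proof (rule wp_For_stored[where xss = bags and i = i and a = "''bag''" and T = "\<lambda>_. 60" and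
      J = "\<lambda>k u. (\<forall>y. y \<notin> {''acc'', ''e'', ''q''} \<longrightarrow> u y = t y) \<and>
         u ''acc'' 0 = first + (\<Sum>u\<in>set (take k xs). f u)"], goal_cases)
    case 1
    then show ?case using t unfolding ready_def by simp
  next
    case 5
    then show ?case using S v j(2) nodes pow[OF vn] init by simp
  next
    case (8 k u)
    define x where "x = xs ! k"
    have k: "k < length xs" using 8(1) unfolding xs_def .
    have x: "u ''bag'' (u ''e'' 0) = int x" using 8(3) unfolding x_def xs_def .
    have frame: "\<forall>y. y \<notin> {''acc'', ''e'', ''q''} \<longrightarrow> u y = t y" using 8(2) by blast
    have bag: "t ''bag'' (u ''e'' 0) = int x" using frame x by simp
    have "x \<in> set xs" using k unfolding x_def by simp
    then have xn: "x < n" using dist bag_less[OF i(1)] by simp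
    have fx: "of_bool ({x, v} \<in> E) * (enc S div 2 ^ x - 2 * (enc S div 2 ^ x div 2)) *
        t ''tab'' ((enc S - 2 ^ x) * int N + int j) = f x"
      using row[of "S - {x}"] finS enc_remove[OF finS, of x] unfolding f_def enc_bit[OF finS]
      by (cases "x \<in> S") simp_all
    have "x \<notin> set (take k xs)"
      using dist(1) k unfolding x_def by (auto simp: in_set_conv_nth nth_eq_iff_index_eq)
    then have sum: "(\<Sum>u\<in>set (take (Suc k) xs). f u) = (\<Sum>u\<in>set (take k xs). f u) + f x"
      using k unfolding x_def by (simp add: take_Suc_conv_app_nth)
    show ?case unfolding wp_simps sum fx[symmetric]
      using 8(2) bag nodes pow[OF xn] mat[OF xn vn] S(2) v(3) j(2) by simp
  next
    case (9 l u)
    have "(\<Sum>u\<in>set xs. f u) = (\<Sum>u | u \<in> S \<and> {u, v} \<in> E. int (count j (S - {u})))"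
      unfolding dist(2) f_def
      by (rule sum.mono_neutral_cong_right) (use finite_bag[of i] i(1) S(1) in auto)
    then have "first + (\<Sum>u\<in>set xs. f u) = int (count i S)"
      unfolding first_def using count_forget[OF _ j(1) v(1,2) S(1)] i(1) by simp
    then show ?case using 9 len unfolding xs_def by simp
  qed (use i t bags_nth(3) in simp_all)
qed


lemma child_neq: "j \<in> ch i \<Longrightarrow> j \<noteq> i"
  using child_edge edge_in_nodes by blast

text \<open>The bag of a leaf is empty, so only the empty set is enumerated and the constant 1 is
  correct.\<close>

lemma wp_leaf_prog:
  assumes s: "ready s" and i: "i < N" "s ''i'' 0 = int i" "ch i = {}"
    and zero: "\<And>m. s ''tab'' (m * int N + int i) = 0"
  shows "wp (row_prog (Set ''acc'' (Const 1))) s (\<lambda>l t. l \<le> 203 * 2 ^ card (X i) \<and>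
    (\<forall>y. y \<notin> {''sub'', ''cnt'', ''e'', ''t'', ''acc'', ''q'', ''tab''} \<longrightarrow> t y = s y) \<and>
    same_rows ({..<N} - {i}) s t \<and> row_ok t i)"
proof (rule wp_mono[OF wp_row_prog[where K = 3, OF s i(1,2) zero]], goal_cases)
  case (1 t S)
  have "X i = {}" using nice i unfolding nice_tree_decomposition_def by simp
  then have "count i S = 1" using 1(3) count_leaf[of i S] i by simp
  then show ?case by (simp add: wp_Assign)
qed simp

lemma wp_introduce_prog:
  assumes s: "ready s" and i: "i < N" "s ''i'' 0 = int i" and j: "ch i = {j}" "s ''j'' 0 = int j" "row_ok s j"
    and v: "v \<notin> X j" "X i = insert v (X j)"
    and zero: "\<And>m. s ''tab'' (m * int N + int i) = 0"
  shows "wp introduce_prog s (\<lambda>l t. l \<le> 230 * 2 ^ card (X i) \<and>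
    (\<forall>y. y \<notin> {''sub'', ''cnt'', ''e'', ''t'', ''acc'', ''q'', ''tab''} \<longrightarrow> t y = s y) \<and>
    same_rows ({..<N} - {i}) s t \<and> row_ok t i)"
  unfolding introduce_prog_def
proof (rule wp_mono[OF wp_row_prog[where K = 30, OF s i zero]], goal_cases)
  case (1 t S)
  have "j \<in> {..<N} - {i}" using j(1) child_in_nodes[of j i] child_neq[of j i] by simp
  from row_ok_cong[OF 1(2) this j(3)] have "row_ok t j" .
  moreover have "finite S" using 1(3) finite_bag[of i] i(1) by (auto intro: finite_subset)
  ultimately have "t ''tab'' (enc S * int N + int j) = int (count i S)"
    using count_introduce[OF _ j(1) v] i(1) unfolding row_ok_def by simp
  moreover have "t ''nodes'' 0 = int N" "t ''j'' 0 = int j"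
    using 1(1) s j(2) unfolding ready_def by simp_all
  ultimately show ?case using 1(4) by (simp add: wp_Assign)
qed simp

text \<open>The two loops that find \<open>v\<close> are linear in the bag sizes; the dominant cost
  is one bag traversal for each subset, whence the factor \<open>card (X i) + 1\<close>.\<close>

lemma wp_forget_prog:
  assumes s: "ready s" and i: "i < N" "s ''i'' 0 = int i" and j: "ch i = {j}" "s ''j'' 0 = int j" "row_ok s j"
    and v: "v \<notin> X i" "X j = insert v (X i)"
    and zero: "\<And>m. s ''tab'' (m * int N + int i) = 0"
  shows "wp forget_prog s (\<lambda>l t. l \<le> 500 * ((card (X i) + 1) * 2 ^ card (X i)) \<and>
    (\<forall>y. y \<notin> {''v'', ''sub'', ''cnt'', ''e'', ''t'', ''acc'', ''q'', ''tab''} \<longrightarrow> t y = s y) \<and>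
    same_rows ({..<N} - {i}) s t \<and> row_ok t i)"
proof -
  have j': "j \<in> {..<N} - {i}" using j(1) child_in_nodes[of j i] child_neq[of j i] by simp
  then have jN: "j < N" by simp
  have fin: "finite (X i)" using finite_bag[of i] i(1) by simp
  have step: "(\<Sum>u\<in>set (take (Suc k) xs). int u) = (\<Sum>u\<in>set (take k xs). int u) + int (xs ! k)"
    if "distinct xs" "k < length xs" for xs k
  proof -
    have "xs ! k \<notin> set (take k xs)"
      using that by (auto simp: in_set_conv_nth nth_eq_iff_index_eq)
    then show ?thesis using that by (simp add: take_Suc_conv_app_nth)
  qed
  show ?thesis
    unfolding forget_prog_def wp_Seq wp_Assign
  proof (rule wp_For_stored[where xss = bags and i = j and a = "''bag''" and T = "\<lambda>_. 10" and
      J = "\<lambda>k t. (\<forall>y. y \<notin> {''v'', ''e''} \<longrightarrow> t y = s y) \<and>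
         t ''v'' 0 = (\<Sum>u\<in>set (take k (bags ! j)). int u)"], goal_cases)
    case 1
    then show ?case using s unfolding ready_def by simp
  next
    case (8 k t)
    then show ?case using step[OF bags_nth(1)[OF jN] 8(1)] by (simp add: wp_simps)
  next
    case l1: (9 l1 t1)
    have t1: "\<forall>y. y \<notin> {''v'', ''e''} \<longrightarrow> t1 y = s y" "t1 ''v'' 0 = (\<Sum>u\<in>X j. int u)"
      using l1(1) bags_nth(2)[OF jN] by simp_all
    show ?case
    proof (rule wp_For_stored[where xss = bags and i = i and a = "''bag''" and T = "\<lambda>_. 10" and
        J = "\<lambda>k t. (\<forall>y. y \<notin> {''v'', ''e''} \<longrightarrow> t y = s y) \<and>
           t ''v'' 0 = (\<Sum>u\<in>X j. int u) - (\<Sum>u\<in>set (take k (bags ! i)). int u)"], goal_cases)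
      case 1
      then show ?case using s t1 unfolding ready_def by simp
    next
      case (8 k t)
      then show ?case using step[OF bags_nth(1)[OF i(1)] 8(1)] by (simp add: wp_simps)
    next
      case l2: (9 l2 t2)
      have t2: "\<forall>y. y \<notin> {''v'', ''e''} \<longrightarrow> t2 y = s y" "t2 ''v'' 0 = int v"
        using l2(1) bags_nth(2)[OF i(1)] v fin by simp_all
      have ready2: "ready t2" using s t2(1) unfolding ready_def by simp
      have i2: "t2 ''i'' 0 = int i" and j2: "t2 ''j'' 0 = int j" using t2(1) i(2) j(2) by simp_all
      have row2: "row_ok t2 j" using j(3) t2(1) unfolding row_ok_def by simp
      have zero2: "\<And>m. t2 ''tab'' (m * int N + int i) = 0" using zero t2(1) by simp
      show ?case
      proof (rule wp_mono[OF wp_row_prog[where K = "75 * card (X i) + 60", OF ready2 i(1) i2 zero2]],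
          goal_cases)
        case (1 t S)
        show ?case
        proof (rule wp_forget_step[where j = j and v = v])
          show "ready t" using ready2 1(1) unfolding ready_def by simp
          show "row_ok t j" by (rule row_ok_cong[OF 1(2) j' row2])
        qed (use 1 i(1) i2 j(1) j2 v t2(2) in simp_all)
      next
        case (2 l t)
        define c where "c = card (X i)"
        define p where "p = (2::nat) ^ c"
        \<comment> \<open>Naming the product makes the cost inequality linear in \<open>c\<close>,
          \<open>p\<close> and \<open>d\<close>.\<close>
        define d where "d = c * p"
        have "card (X j) = c + 1" using v fin unfolding c_def by simp
        then have "l1 \<le> 25 * c + 45" "l2 \<le> 25 * c + 20"
          using l1(2) l2(2) length_bag[OF jN] length_bag[OF i(1)] unfolding c_def by simp_all
        moreover have "l \<le> 75 * d + 260 * p"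
          using 2 unfolding c_def d_def p_def by (simp add: algebra_simps)
        moreover have "1 \<le> p" "c \<le> d" unfolding d_def p_def by simp_all
        ultimately have "3 + l1 + l2 + l \<le> 500 * d + 500 * p" by linarith
        then have "3 + (l1 + (l2 + l)) \<le> 500 * ((c + 1) * 2 ^ c)"
          unfolding d_def p_def by (simp add: algebra_simps)
        moreover have "same_rows ({..<N} - {i}) s t"
          using 2 t2(1) unfolding same_rows_def by simp
        ultimately show ?case using 2 t2(1) unfolding c_def[symmetric] by simp
      qed
    qed (use i t1 bags_nth(3) in simp_all)
  qed (use jN j s bags_nth(3) in simp_all)
qed

text \<open>Links the enumeration by pairs to the recurrence: for a fixed union \<open>S\<close> a
  disjoint pair is determined by its first set, and a set \<open>S\<close> not inside
  \<open>Y\<close> is the union of no pair.\<close>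

lemma sum_disjoint_pairs:
  fixes g :: "nat set \<Rightarrow> nat set \<Rightarrow> int"
  assumes "finite Y"
  shows "(\<Sum>p | p \<in> {(A, B). A \<union> B \<subseteq> Y \<and> A \<inter> B = {}}. if fst p \<union> snd p = S then g (fst p) (snd p) else 0) =
    (if S \<subseteq> Y then \<Sum>A\<in>Pow S. g A (S - A) else 0)"
proof -
  define D where "D = {(A, B). A \<union> B \<subseteq> Y \<and> A \<inter> B = {}}"
  have fin: "finite D"
    by (rule finite_subset[of _ "Pow Y \<times> Pow Y"]) (use assms in \<open>auto simp: D_def\<close>)
  have "(\<Sum>p\<in>D. if fst p \<union> snd p = S then g (fst p) (snd p) else 0) =
      (\<Sum>p | p \<in> D \<and> fst p \<union> snd p = S. g (fst p) (snd p))"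
    by (rule sum.inter_filter[symmetric]) (rule fin)
  also have "\<dots> = (if S \<subseteq> Y then \<Sum>A\<in>Pow S. g A (S - A) else 0)"
  proof (cases "S \<subseteq> Y")
    case True
    have "(\<Sum>p | p \<in> D \<and> fst p \<union> snd p = S. g (fst p) (snd p)) = (\<Sum>A\<in>Pow S. g A (S - A))"
    proof (rule sum.reindex_bij_witness[where i = "\<lambda>A. (A, S - A)" and j = fst])
      fix p assume p: "p \<in> {p. p \<in> D \<and> fst p \<union> snd p = S}"
      then have "S - fst p = snd p" unfolding D_def by auto
      then show "(fst p, S - fst p) = p" "g (fst p) (S - fst p) = g (fst p) (snd p)" by simp_all
      show "fst p \<in> Pow S" using p by auto
    qed (use True in \<open>auto simp: D_def\<close>)
    then show ?thesis using True by simp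
  next
    case False
    then have none: "{p. p \<in> D \<and> fst p \<union> snd p = S} = {}" unfolding D_def by auto
    show ?thesis unfolding none using False by simp
  qed
  finally show ?thesis unfolding D_def by simp
qed

lemma wp_join_prog:
  assumes s: "ready s" and i: "i < N" "s ''i'' 0 = int i"
    and jk: "ch i = {j, k}" "j \<noteq> k" "s ''j'' 0 = int j" "s ''k'' 0 = int k" "row_ok s j" "row_ok s k"
    and zero: "\<And>m. s ''tab'' (m * int N + int i) = 0"
  shows "wp join_prog s (\<lambda>l t. l \<le> 400 * 3 ^ card (X i) \<and>
    (\<forall>y. y \<notin> {''pa'', ''pb'', ''cnt'', ''e'', ''t'', ''q'', ''tab''} \<longrightarrow> t y = s y) \<and>
    same_rows ({..<N} - {i}) s t \<and> row_ok t i)"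
  unfolding join_prog_def wp_Seq
proof (rule wp_mono[OF wp_pairs_prog[OF s i]], goal_cases)
  case (1 l1 t1)
  define L where "L = pair_list (bags ! i)"
  define M where "M = (3::nat) ^ card (X i)"
  define g where "g A B = int (count j A) * int (count k B)" for A B
  have fin: "finite (X i)" using finite_bag[of i] i(1) by simp
  have lenL: "length L = M"
    unfolding L_def M_def by (simp add: length_pair_list length_bag[OF i(1)])
  have setL: "distinct L" "set L = {(A, B). A \<union> B \<subseteq> X i \<and> A \<inter> B = {}}"
    using pair_list_distinct_set[of "bags ! i"] bags_nth(1,2)[OF i(1)] unfolding L_def by simp_all
  have l1: "l1 \<le> 200 * M" and t1: "\<forall>y. y \<notin> {''pa'', ''pb'', ''cnt'', ''e'', ''t''} \<longrightarrow> t1 y = s y"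
    "t1 ''cnt'' 0 = int M" "\<forall>m<M. t1 ''pa'' (int m) = enc (fst (L ! m)) \<and> t1 ''pb'' (int m) = enc (snd (L ! m))"
    using 1 unfolding L_def M_def by blast+
  have jk': "j \<in> {..<N} - {i}" "k \<in> {..<N} - {i}"
    using jk(1) child_in_nodes[of j i] child_in_nodes[of k i] child_neq[of j i] child_neq[of k i] by simp_all
  show ?case
  proof (rule wp_For_uniform[where m = M and K = 60 and J = "\<lambda>q t.
      (\<forall>y. y \<notin> {''pa'', ''pb'', ''cnt'', ''e'', ''t'', ''q'', ''tab''} \<longrightarrow> t y = s y) \<and>
      t ''t'' 0 = int q \<and> t ''cnt'' 0 = int M \<and> t ''pa'' = t1 ''pa'' \<and> t ''pb'' = t1 ''pb'' \<and>
      same_rows ({..<N} - {i}) s t \<and> (\<forall>S. finite S \<longrightarrow> t ''tab'' (enc S * int N + int i) =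
        (\<Sum>p\<in>set (take q L). if fst p \<union> snd p = S then g (fst p) (snd p) else 0))"], goal_cases)
    case 1
    then show ?case using t1 zero unfolding same_rows_def by simp
  next
    case (2 q t)
    then show ?case by simp
  next
    case (3 q t)
    define A where "A = fst (L ! q)"
    define B where "B = snd (L ! q)"
    have "L ! q \<in> set L" using 3(1) lenL by simp
    then have AB: "A \<union> B \<subseteq> X i" "A \<inter> B = {}" unfolding setL(2) A_def B_def by (auto simp: case_prod_beta)
    then have finAB: "finite A" "finite B" using fin by (auto intro: finite_subset)
    have pab: "t ''pa'' (int q) = enc A" "t ''pb'' (int q) = enc B"
      using 3 t1(3) unfolding A_def B_def by simp_all
    have frame: "\<forall>y. y \<notin> {''pa'', ''pb'', ''cnt'', ''e'', ''t'', ''q'', ''tab''} \<longrightarrow> t y = s y"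
      and rows: "same_rows ({..<N} - {i}) s t" and tq: "t ''t'' 0 = int q" using 3(2) by blast+
    have t: "t ''nodes'' 0 = int N" "t ''i'' 0 = int i" "t ''j'' 0 = int j" "t ''k'' 0 = int k"
      using frame s i(2) jk(3,4) unfolding ready_def by simp_all
    have rowj: "t ''tab'' (enc A * int N + int j) = int (count j A)"
      using row_ok_cong[OF rows jk'(1) jk(5)] finAB unfolding row_ok_def by simp
    have rowk: "t ''tab'' (enc B * int N + int k) = int (count k B)"
      using row_ok_cong[OF rows jk'(2) jk(6)] finAB unfolding row_ok_def by simp
    \<comment> \<open>The list has no repetitions, so the product about to be added is not yet in
      the sum.\<close>
    have notin: "L ! q \<notin> set (take q L)"
      using setL(1) 3(1) lenL by (auto simp: in_set_conv_nth nth_eq_iff_index_eq)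
    define z where "z = enc (A \<union> B) * int N + int i"
    have z: "(enc A + enc B) * int N + int i = z"
      unfolding z_def enc_Un[OF finAB AB(2)] ..
    define u where "u = t(''q'' := (t ''q'')(0 := z),
      ''tab'' := (t ''tab'')(z := t ''tab'' z + g A B), ''t'' := (t ''t'')(0 := int q + 1))"
    have rows': "same_rows ({..<N} - {i}) s u"
      by (rule same_rows_write[OF rows i(1), of _ "enc (A \<union> B)"]) (simp add: u_def z_def)
    have row': "u ''tab'' (enc S * int N + int i) =
        (\<Sum>p\<in>set (take (Suc q) L). if fst p \<union> snd p = S then g (fst p) (snd p) else 0)"
      if "finite S" for S
    proof -
      have "enc S * int N + int i = z \<longleftrightarrow> A \<union> B = S"
        unfolding z_def index_inject[OF i(1) i(1)] using enc_inject[of S "A \<union> B"] that finAB by auto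
      then have "u ''tab'' (enc S * int N + int i) = t ''tab'' (enc S * int N + int i) +
          (if A \<union> B = S then g A B else 0)"
        unfolding u_def by (cases "A \<union> B = S") simp_all
      also have "t ''tab'' (enc S * int N + int i) =
          (\<Sum>p\<in>set (take q L). if fst p \<union> snd p = S then g (fst p) (snd p) else 0)"
        using 3(2) that by blast
      finally show ?thesis
        using 3(1) lenL notin unfolding A_def B_def by (simp add: take_Suc_conv_app_nth)
    qed
    have "\<forall>y. y \<notin> {''pa'', ''pb'', ''cnt'', ''e'', ''t'', ''q'', ''tab''} \<longrightarrow> u y = s y"
      "u ''t'' 0 = int (Suc q)" "u ''cnt'' 0 = int M" "u ''pa'' = t1 ''pa''" "u ''pb'' = t1 ''pb''"
      using 3(2) frame unfolding u_def by simp_all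
    moreover have "wp (Seq (Set ''q'' (Add (Mul (Add (Cell ''pa'' (Var ''t'')) (Cell ''pb'' (Var ''t''))) (Var ''nodes'')) (Var ''i'')))
       (Assign ''tab'' (Var ''q'') (Add (Cell ''tab'' (Var ''q'')) (Mul
         (Cell ''tab'' (Add (Mul (Cell ''pa'' (Var ''t'')) (Var ''nodes'')) (Var ''j'')))
         (Cell ''tab'' (Add (Mul (Cell ''pb'' (Var ''t'')) (Var ''nodes'')) (Var ''k'')))))))
       t (\<lambda>l t'. l \<le> 60 \<and> t'(''t'' := (t' ''t'')(0 := t' ''t'' 0 + 1)) = u)"
      unfolding u_def g_def by (simp add: wp_simps tq pab t rowj rowk z fun_upd_twist)
    ultimately show ?case
      using rows' row' by (elim wp_mono) simp
  next
    case (4 l t)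
    have "row_ok t i" unfolding row_ok_def
    proof (intro allI impI)
      fix S :: "nat set" assume "finite S"
      then have "t ''tab'' (enc S * int N + int i) =
          (\<Sum>p\<in>set L. if fst p \<union> snd p = S then g (fst p) (snd p) else 0)"
        using 4(1) lenL by simp
      also have "\<dots> = (if S \<subseteq> X i then \<Sum>A\<in>Pow S. g A (S - A) else 0)"
        using sum_disjoint_pairs[OF fin, of S g] unfolding setL(2) by simp
      also have "\<dots> = int (count i S)"
        using count_join[OF _ jk(1,2), of S] i(1) unfolding g_def by (simp add: count_def)
      finally show "t ''tab'' (enc S * int N + int i) = int (count i S)" .
    qed
    moreover have "l1 + l \<le> 400 * M"
    proof -
      have "1 \<le> M" unfolding M_def by simp
      then show ?thesis using l1 4(2) by simp
    qed
    ultimately show ?case using 4(1) unfolding M_def by blast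
  qed
qed

end

section \<open>The whole program and its running time\<close>

text \<open>The node type is read off sizes alone: the difference of two offsets is the number of
  children, and at a single child the larger of the two bags tells introduce from forget.\<close>

definition process_prog :: com where
  "process_prog = Seq (Set ''c'' (Cell ''child_start'' (Var ''i'')))
    (Seq (Set ''d'' (Sub (Cell ''child_start'' (Add (Var ''i'') (Const 1))) (Var ''c'')))
    (If (Eq (Var ''d'') (Const 0)) (row_prog (Set ''acc'' (Const 1)))
    (Seq (Set ''j'' (Cell ''child'' (Var ''c'')))
    (If (Eq (Var ''d'') (Const 1))
      (If (Less (Sub (Cell ''bag_start'' (Add (Var ''j'') (Const 1))) (Cell ''bag_start'' (Var ''j'')))
            (Sub (Cell ''bag_start'' (Add (Var ''i'') (Const 1))) (Cell ''bag_start'' (Var ''i''))))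
        introduce_prog forget_prog)
      (Seq (Set ''k'' (Cell ''child'' (Add (Var ''c'') (Const 1)))) join_prog)))))"

definition main_prog :: com where
  "main_prog = Seq pow_prog (Seq adj_prog (Seq order_prog (Seq
    (For ''h'' (Const 0) (Var ''nodes'')
      (Seq (Set ''i'' (Cell ''order'' (Sub (Sub (Var ''nodes'') (Const 1)) (Var ''h''))))
        process_prog))
    (Set ''result'' (Cell ''tab'' (Var ''root''))))))"

text \<open>Of these only \<open>tab\<close> carries information from node to node, and what happens
  to it is left to \<open>same_rows\<close> and \<open>row_ok\<close>.\<close>

abbreviation scratch :: "string set" where
  "scratch \<equiv> {''c'', ''d'', ''j'', ''k'', ''v'', ''sub'', ''pa'', ''pb'', ''cnt'', ''e'', ''t'',
    ''acc'', ''q'', ''tab''}"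

section \<open>Cost of one node and of the whole run\<close>

context dp_input
begin

definition node_cost :: "nat \<Rightarrow> nat" where
  "node_cost i = (if card (ch i) = 2 then 500 * 3 ^ card (X i)
     else 600 * ((card (X i) + 1) * 2 ^ card (X i)))"

lemma card_children_le: "i < N \<Longrightarrow> card (ch i) \<le> 2"
  using nice unfolding nice_tree_decomposition_def by blast

lemma unary_cases:
  assumes "i < N" "ch i = {j}"
  obtains v where "v \<notin> X j" "X i = insert v (X j)" | v where "v \<notin> X i" "X j = insert v (X i)"
proof -
  have "i \<in> {..<N}" using assms by simp
  with nice have "\<forall>j. ch i = {j} \<longrightarrow>
      (\<exists>v. v \<notin> X j \<and> X i = insert v (X j)) \<or> (\<exists>v. v \<notin> X i \<and> X j = insert v (X i))"
    unfolding nice_tree_decomposition_def by blast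
  then show thesis using assms(2) that by blast
qed

lemma wp_process_prog:
  assumes s: "ready s" and i: "i < N" "s ''i'' 0 = int i"
    and children: "\<And>j. j \<in> ch i \<Longrightarrow> row_ok s j"
    and zero: "\<And>m. s ''tab'' (m * int N + int i) = 0"
    and post: "\<And>l t. l \<le> node_cost i \<Longrightarrow> \<forall>y. y \<notin> scratch \<longrightarrow> t y = s y \<Longrightarrow>
      same_rows ({..<N} - {i}) s t \<Longrightarrow> row_ok t i \<Longrightarrow> Q l t"
  shows "wp process_prog s Q"
proof -
  define cs where "cs = chs ! i"
  have cs: "distinct cs" "set cs = ch i" "length cs = card (ch i)"
    using chs_nth(1)[OF i(1)] distinct_card[of cs] unfolding cs_def by auto
  have pos: "s ''child_start'' (int i + 1) = s ''child_start'' (int i) + int (length cs)"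
    and elem: "\<And>m. m < length cs \<Longrightarrow> s ''child'' (s ''child_start'' (int i) + int m) = int (cs ! m)"
    using s i(1) chs_nth(2) unfolding ready_def stored_def cs_def by simp_all
  have bag_pos: "s ''bag_start'' (int j + 1) - s ''bag_start'' (int j) = int (card (X j))" if "j < N" for j
    using s that bags_nth(3) length_bag unfolding ready_def stored_def by simp
  have two: "card (ch i) \<le> 2" using card_children_le[OF i(1)] .
  have one: "1 \<le> (2::nat) ^ card (X i)" "1 \<le> (3::nat) ^ card (X i)" by simp_all
  have ready_cong: "ready t" if "\<forall>y. y \<notin> scratch \<longrightarrow> t y = s y" for t
    using that s unfolding ready_def by simp
  have rows_cong: "row_ok t j" if "t ''tab'' = s ''tab''" "j \<in> ch i" for t j
    using that children unfolding row_ok_def by simp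
  consider "cs = []" | j where "cs = [j]" | j k where "cs = [j, k]"
    using two cs(3) by (cases cs; cases "tl cs"; cases "tl (tl cs)") auto
  then show ?thesis
  proof cases
    case 1
    define s' where "s' = s(''c'' := (s ''c'')(0 := s ''child_start'' (int i)), ''d'' := (s ''d'')(0 := 0))"
    \<comment> \<open>20 is the exact cost of the two assignments and the test before this branch;
      50 and 37 below are the corresponding costs for one and two children.\<close>
    have "wp (row_prog (Set ''acc'' (Const 1))) s' (\<lambda>l t. Q (20 + l) t)"
    proof (rule wp_mono[OF wp_leaf_prog[where i = i]], goal_cases)
      case 1 show ?case by (rule ready_cong) (simp add: s'_def)
    next
      case (6 l t)
      show ?case
      proof (rule post)
        have "600 * 2 ^ card (X i) \<le> node_cost i"
          using cs(3) \<open>cs = []\<close> unfolding node_cost_def by simp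
        moreover have "l \<le> 203 * 2 ^ card (X i)" using 6 by blast
        ultimately show "20 + l \<le> node_cost i" using one by linarith
      qed (use 6 in \<open>simp_all add: s'_def same_rows_def\<close>)
    qed (use i cs(2) \<open>cs = []\<close> zero in \<open>simp_all add: s'_def\<close>)
    then show ?thesis
      unfolding process_prog_def using i pos \<open>cs = []\<close> by (simp add: wp_simps s'_def numeral_eq_Suc)
  next
    case (2 j)
    have ch: "ch i = {j}" using cs(2) 2 by simp
    then have jN: "j < N" using child_in_nodes[of j i] by simp
    define s' where "s' = s(''c'' := (s ''c'')(0 := s ''child_start'' (int i)), ''d'' := (s ''d'')(0 := 1),
      ''j'' := (s ''j'')(0 := int j))"
    have s': "ready s'" "s' ''i'' 0 = int i" "s' ''j'' 0 = int j"
      "\<And>m. s' ''tab'' (m * int N + int i) = 0" "row_ok s' j"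
      by (rule ready_cong) (use i zero ch in \<open>simp_all add: s'_def rows_cong\<close>)
    have fin: "finite (X i)" "finite (X j)" using finite_bag[of i] finite_bag[of j] i(1) jN by simp_all
    have child: "s ''child'' (s ''child_start'' (int i)) = int j" using elem[of 0] 2 by simp
    have cost: "node_cost i = 600 * ((card (X i) + 1) * 2 ^ card (X i))"
      using ch unfolding node_cost_def by simp
    from i(1) ch show ?thesis
    proof (cases rule: unary_cases)
      case v: 1
      have "wp introduce_prog s' (\<lambda>l t. Q (50 + l) t)"
      proof (rule wp_mono[OF wp_introduce_prog[OF s'(1) i(1) s'(2) ch s'(3,5) v s'(4)]], goal_cases)
        case (1 l t)
        show ?case
        proof (rule post)
          have "l \<le> 230 * 2 ^ card (X i)" using 1 by blast
          moreover have "600 * 2 ^ card (X i) \<le> node_cost i" unfolding cost by simp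
          ultimately show "50 + l \<le> node_cost i" using one by linarith
        qed (use 1 in \<open>simp_all add: s'_def same_rows_def\<close>)
      qed
      moreover have "card (X j) < card (X i)" using v fin by simp
      ultimately show ?thesis
        unfolding process_prog_def using i pos child 2 bag_pos[OF i(1)] bag_pos[OF jN]
        by (simp add: wp_simps s'_def numeral_eq_Suc)
    next
      case v: 2
      have "wp forget_prog s' (\<lambda>l t. Q (50 + l) t)"
      proof (rule wp_mono[OF wp_forget_prog[OF s'(1) i(1) s'(2) ch s'(3,5) v s'(4)]], goal_cases)
        case (1 l t)
        show ?case
        proof (rule post)
          have "l \<le> 500 * ((card (X i) + 1) * 2 ^ card (X i))" using 1 by blast
          moreover have "1 \<le> (card (X i) + 1) * 2 ^ card (X i)" by (simp add: Suc_le_eq)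
          ultimately show "50 + l \<le> node_cost i" unfolding cost by linarith
        qed (use 1 in \<open>simp_all add: s'_def same_rows_def\<close>)
      qed
      moreover have "\<not> card (X j) < card (X i)" using v fin by simp
      ultimately show ?thesis
        unfolding process_prog_def using i pos child 2 bag_pos[OF i(1)] bag_pos[OF jN]
        by (simp add: wp_simps s'_def numeral_eq_Suc)
    qed
  next
    case (3 j k)
    have ch: "ch i = {j, k}" "j \<noteq> k" using cs(1,2) 3 by auto
    define s' where "s' = s(''c'' := (s ''c'')(0 := s ''child_start'' (int i)), ''d'' := (s ''d'')(0 := 2),
      ''j'' := (s ''j'')(0 := int j), ''k'' := (s ''k'')(0 := int k))"
    have s': "ready s'" "s' ''i'' 0 = int i" "s' ''j'' 0 = int j" "s' ''k'' 0 = int k" "row_ok s' j" "row_ok s' k"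
      "\<And>m. s' ''tab'' (m * int N + int i) = 0"
      by (rule ready_cong) (use i zero ch in \<open>simp_all add: s'_def rows_cong\<close>)
    have child: "s ''child'' (s ''child_start'' (int i)) = int j"
      "s ''child'' (s ''child_start'' (int i) + 1) = int k" using elem[of 0] elem[of 1] 3 by simp_all
    have "wp join_prog s' (\<lambda>l t. Q (37 + l) t)"
    proof (rule wp_mono[OF wp_join_prog[OF s'(1) i(1) s'(2) ch s'(3-7)]], goal_cases)
      case (1 l t)
      show ?case
      proof (rule post)
        have "l \<le> 400 * 3 ^ card (X i)" using 1 by blast
        moreover have "node_cost i = 500 * 3 ^ card (X i)" using ch unfolding node_cost_def by simp
        ultimately show "37 + l \<le> node_cost i" using one by linarith
      qed (use 1 in \<open>simp_all add: s'_def same_rows_def\<close>)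
    qed
    then show ?thesis
      unfolding process_prog_def using i pos child 3 by (simp add: wp_simps s'_def numeral_eq_Suc)
  qed
qed

lemma wp_main_prog:
  assumes s: "s = initial_state adj r chs bags" and adj: "lists_represent n (\<lambda>v. {u. {v, u} \<in> E}) adj"
    and B: "\<And>i. i < N \<Longrightarrow> node_cost i \<le> B"
  shows "wp main_prog s (\<lambda>l t. result t = int (num_perfect_matchings {..<n} E) \<and>
    l \<le> 300 * (n + length (concat adj) + N + 1) + N * (B + 40))"
proof -
  have adj': "length adj = n" "\<And>v. v < n \<Longrightarrow> set (adj ! v) = {u. {v, u} \<in> E}"
    using adj unfolding lists_represent_def by simp_all
  have single: "array_of [m] 0 = int m" for m unfolding array_of_def by simp
  have init: "s ''n'' 0 = int n" "s ''nodes'' 0 = int N" "s ''root'' 0 = int r"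
    "stored adj (s ''adj_start'') (s ''adj'')" "stored chs (s ''child_start'') (s ''child'')"
    "stored bags (s ''bag_start'') (s ''bag'')" "s ''mat'' = (\<lambda>z. 0)" "s ''tab'' = (\<lambda>z. 0)"
    unfolding s initial_state_def using adj'(1) bags_nth(3) stored_offsets by (simp_all add: single)
  have adj_bound: "set (adj ! v) \<subseteq> {..<n}" if "v < n" for v
    using adj'(2)[OF that] edgeD by auto
  have two: "length (chs ! i) \<le> 2" if "i < N" for i
    using chs_nth(1)[OF that] distinct_card[of "chs ! i"] card_children_le[OF that] by simp
  define order where "order q = bfs chs r N ! q" for q
  have order: "order q < N" if "q < N" for q
    using bfs_complete that nth_mem[of q "bfs chs r N"] unfolding order_def by simp
  have order_inj: "order q = order q' \<longleftrightarrow> q = q'" if "q < N" "q' < N" for q q'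
    using bfs_complete that unfolding order_def by (simp add: nth_eq_iff_index_eq)
  show ?thesis
    unfolding main_prog_def wp_Seq[of pow_prog] wp_Seq[of adj_prog] wp_Seq[of order_prog]
  proof (rule wp_mono[OF wp_pow_prog[of s n, OF init(1)]], goal_cases)
    case 1: (1 l1 t1)
    show ?case
    proof (rule wp_mono[OF wp_adj_prog[OF _ adj'(1) _ _ adj_bound]], goal_cases)
      case 2: (5 l2 t2)
      show ?case
      proof (rule wp_mono[OF wp_order_prog[OF _ _ _ two]], goal_cases)
        case 3: (5 l3 t3)
        have t3: "\<forall>y. y \<notin> {''pow'', ''v'', ''mat'', ''e'', ''order'', ''tail'', ''h'', ''i''} \<longrightarrow> t3 y = s y"
          using 1 2 3 by simp
        have ready3: "ready t3"
          using t3 init 1 2 3 adj'(2) unfolding ready_def by simp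
        show ?case unfolding wp_Seq
        \<comment> \<open>Positions below \<open>N - h\<close> are pending and their rows still
          zero, which every node program takes as its starting point; the later positions are
          done.\<close>
        proof (rule wp_For_uniform[where m = N and K = "B + 11" and J = "\<lambda>h t.
            (\<forall>y. y \<notin> insert ''i'' (insert ''h'' scratch) \<longrightarrow> t y = t3 y) \<and> t ''h'' 0 = int h \<and>
            (\<forall>q<N - h. \<forall>m. t ''tab'' (m * int N + int (order q)) = 0) \<and>
            (\<forall>q. N - h \<le> q \<and> q < N \<longrightarrow> row_ok t (order q))"], goal_cases)
          case 1
          show ?case using t3 init by simp (intro allI impI, erule conjE, erule (1) notE[OF leD])
        next
          case (2 h t)
          then show ?case using t3 init by simp
        next
          case loop: (3 h t)
          define q where "q = N - 1 - h"
          have q: "q < N" "N - h = Suc q" "N - Suc h = q" using loop(1) unfolding q_def by simp_all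
          note frame = conjunct1[OF loop(2)]
          note h = conjunct1[OF conjunct2[OF loop(2)]]
          have zeros: "t ''tab'' (m * int N + int (order q')) = 0" if "q' < N - h" for q' m
            using conjunct1[OF conjunct2[OF conjunct2[OF loop(2)]]] that by simp
          have oks: "row_ok t (order q')" if "N - h \<le> q'" "q' < N" for q'
            using conjunct2[OF conjunct2[OF conjunct2[OF loop(2)]]] that by simp
          define i where "i = order q"
          have iN: "i < N" using order q(1) unfolding i_def by simp
          define t' where "t' = t(''i'' := (t ''i'')(0 := int i))"
          have "int N - 1 - int h = int q" using q(1,2) loop(1) by linarith
          moreover have "t ''order'' = t3 ''order''" using loop(2) by simp
          moreover have "t3 ''order'' (int q) = int i" using 3 q(1) unfolding i_def order_def by blast
          ultimately have "t ''order'' (int N - 1 - int h) = int i" by simp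
          moreover have "t ''nodes'' 0 = int N" using frame ready3 unfolding ready_def by simp
          moreover have "wp process_prog t' (\<lambda>l u. 10 + l \<le> B + 11 \<and>
             (\<forall>y. y \<notin> insert ''i'' (insert ''h'' scratch) \<longrightarrow>
                (u(''h'' := (u ''h'')(0 := u ''h'' 0 + 1))) y = t3 y) \<and>
             (u(''h'' := (u ''h'')(0 := u ''h'' 0 + 1))) ''h'' 0 = int (Suc h) \<and>
             (\<forall>q'<N - Suc h. \<forall>m. (u(''h'' := (u ''h'')(0 := u ''h'' 0 + 1))) ''tab''
                (m * int N + int (order q')) = 0) \<and>
             (\<forall>q'. N - Suc h \<le> q' \<and> q' < N \<longrightarrow> row_ok (u(''h'' := (u ''h'')(0 := u ''h'' 0 + 1))) (order q')))"
          proof (rule wp_process_prog[OF _ iN], goal_cases)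
            case 1
            then show ?case using frame ready3 unfolding t'_def ready_def by simp
          next
            case 2
            then show ?case by (simp add: t'_def)
          next
            \<comment> \<open>Children stand later in the order, so they are among the finished
              positions.\<close>
            case (3 j)
            then obtain q' where "q < q'" "q' < N" "order q' = j"
              using bfs_child_later[OF q(1)] unfolding i_def order_def by blast
            then have "row_ok t j" using oks[of q'] q(2) by simp
            then show ?case unfolding row_ok_def t'_def by simp
          next
            case (4 m)
            then show ?case using zeros[of q] q(2) unfolding t'_def i_def by simp
          next
            case (5 l u)
            have others: "same_rows {order q'} t u" if "q' < N" "q' \<noteq> q" for q'
              using 5(3) order[OF that(1)] order_inj[OF that(1) q(1)] that(2)
              unfolding same_rows_def t'_def i_def by simp
            have zero: "u ''tab'' (m * int N + int (order q')) = 0" if "q' < q" for q' m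
              using others[of q'] that q(1,2) zeros[of q'] unfolding same_rows_def by simp
            have rows: "row_ok u (order q')" if "q \<le> q'" "q' < N" for q'
            proof (cases "q' = q")
              case True
              then show ?thesis using 5(4) unfolding i_def by simp
            next
              case False
              then have "row_ok t (order q')" using that oks[of q'] q(2) by simp
              then show ?thesis using row_ok_cong[OF others[OF that(2) False]] by simp
            qed
            show ?case
              using 5(1,2) B[OF iN] frame h zero rows unfolding q(3) t'_def row_ok_def by simp
          qed
          ultimately show ?case
            unfolding wp_Seq wp_Assign using h by (simp add: t'_def)
        next
          case fin: (4 l t)
          have "r = order 0" using bfs_invariant[of N] unfolding order_def by simp
          moreover have "0 < N" using root by simp
          ultimately have "row_ok t r" using fin(1) by simp
          \<comment> \<open>The empty set has code 0, so its entry in the root's row is the cell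
            indexed by the root itself.\<close>
          then have "t ''tab'' (int r) = int (count r {})" unfolding row_ok_def using enc_empty
            by (metis add_0 finite.emptyI mult_zero_left)
          moreover have "t ''root'' 0 = int r" using fin(1) t3 init(3) by simp
          moreover have "l1 + (l2 + (l3 + (l + 5))) \<le> 300 * (n + length (concat adj) + N + 1) + N * (B + 40)"
            using 1 2 3 fin(2) by (simp add: algebra_simps)
          ultimately show ?case unfolding wp_Assign result_def count_root by simp
        qed
      qed (use 1 2 init in simp_all)
    qed (use 1 init in simp_all)
  qed
qed

text \<open>Each ordered pair of neighbours is charged to a node whose bag contains both.\<close>

lemma sum_degrees_le:
  assumes adj: "lists_represent n (\<lambda>v. {u. {v, u} \<in> E}) adj" and b: "\<And>i. i < N \<Longrightarrow> card (X i) \<le> b"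
  shows "length (concat adj) \<le> N * b\<^sup>2"
proof -
  have adj': "length adj = n" "\<And>v. v < n \<Longrightarrow> distinct (adj ! v) \<and> set (adj ! v) = {u. {v, u} \<in> E}"
    using adj unfolding lists_represent_def by simp_all
  have "length (concat adj) = (\<Sum>v<n. card {u. {v, u} \<in> E})"
    using adj' distinct_card by (fastforce simp: length_concat sum_list_sum_nth atLeast0LessThan intro!: sum.cong)
  also have "\<dots> = card (SIGMA v:{..<n}. {u. {v, u} \<in> E})"
    by (rule card_SigmaI[symmetric]) (use adj'(2) in \<open>auto, metis List.finite_set\<close>)
  also have "\<dots> \<le> card (\<Union>i<N. X i \<times> X i)"
  proof (rule card_mono)
    show "finite (\<Union>i<N. X i \<times> X i)" using finite_bag by auto
    show "(SIGMA v:{..<n}. {u. {v, u} \<in> E}) \<subseteq> (\<Union>i<N. X i \<times> X i)"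
    proof clarify
      fix v u assume "{v, u} \<in> E"
      then obtain i where "i < N" "{v, u} \<subseteq> X i"
        using decomposition unfolding tree_decomposition_def by blast
      then show "(v, u) \<in> (\<Union>i<N. X i \<times> X i)" by blast
    qed
  qed
  also have "\<dots> \<le> (\<Sum>i<N. card (X i \<times> X i))" by (rule card_UN_le) simp
  also have "\<dots> \<le> (\<Sum>i<N. b\<^sup>2)"
    by (rule sum_mono) (use b in \<open>auto simp: card_cartesian_product power2_eq_square intro: mult_le_mono\<close>)
  finally show ?thesis by simp
qed

end

section \<open>Comparing the costs with the two claimed bounds\<close>

lemma mult_pow2_le_pow3: "(w + 2) * 2 ^ (w + 1) \<le> 4 * (3::nat) ^ w"
proof (induction w)
  case (Suc w)
  have "(Suc w + 2) * 2 ^ (Suc w + 1) = (2 * w + 6) * (2::nat) ^ (w + 1)"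
    by (simp add: algebra_simps)
  \<comment> \<open>Raising \<open>w\<close> by one doubles the power and raises the linear factor
    from \<open>w + 2\<close> to \<open>w + 3\<close>, altogether at most a factor 3.\<close>
  also have "\<dots> \<le> (3 * (w + 2)) * 2 ^ (w + 1)" by (rule mult_right_mono) simp_all
  also have "\<dots> = 3 * ((w + 2) * 2 ^ (w + 1))" by (simp only: mult.assoc)
  also have "\<dots> \<le> 3 * (4 * 3 ^ w)" using Suc by (rule mult_left_mono) simp
  finally show ?case by simp
qed simp

lemma square_le_pow3: "(w + 1)\<^sup>2 \<le> 4 * (3::nat) ^ w"
proof -
  have "w + 1 \<le> 2 ^ (w + 1)" using less_exp[of "w + 1"] by (rule less_imp_le)
  then have "(w + 1)\<^sup>2 \<le> (w + 2) * 2 ^ (w + 1)"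
    unfolding power2_eq_square by (intro mult_mono) simp_all
  then show ?thesis using mult_pow2_le_pow3[of w] by simp
qed

text \<open>\<open>Z\<close> stands for \<open>3 ^ w\<close> or \<open>w * 2 ^ w\<close>, so one
  estimate serves both bounds. In units of \<open>Z * n\<close>, the vertices and the constant give
  600, and \<open>5140 * c\<close> collects 1200 from the edges, 300 and 40 from the number of nodes
  and 3600 from the node costs.\<close>

lemma total_time_le:
  fixes n N d b B c Z :: nat
  assumes "d \<le> N * b" "b \<le> 4 * Z" "B \<le> 3600 * Z" "N \<le> c * n" "1 \<le> n" "1 \<le> Z"
  shows "300 * (n + d + N + 1) + N * (B + 40) \<le> (600 + 5140 * c) * (Z * n)"
proof -
  define y where "y = Z * n"
  define x where "x = c * y"
  have "d \<le> (c * n) * (4 * Z)" using assms(1,2,4) mult_le_mono order_trans by blast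
  then have d: "d \<le> 4 * x" unfolding x_def y_def by (simp add: ac_simps)
  have "N * B \<le> (c * n) * (3600 * Z)" using assms(3,4) by (rule mult_le_mono[rotated])
  then have B: "N * B \<le> 3600 * x" unfolding x_def y_def by (simp add: ac_simps)
  have "n * 1 \<le> n * Z" using assms(6) by (rule mult_left_mono) simp
  then have n: "n \<le> y" unfolding y_def by (simp add: ac_simps)
  then have N: "N \<le> x" using assms(4) unfolding x_def by (meson le_trans mult_le_mono2)
  have "300 * n + 300 * d + 300 * N + 300 + (N * B + 40 * N) \<le> 600 * y + 5140 * x"
    using d B n N assms(5) by linarith
  then show ?thesis unfolding x_def y_def by (simp add: algebra_simps)
qed

text \<open>The program is fixed before \<open>c\<close>, and \<open>C\<close> depends on
  \<open>c\<close> alone. The path bound asks for \<open>1 \<le> w\<close> because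
  \<open>w * 2 ^ w\<close> vanishes at \<open>w = 0\<close>, whereas every run takes positive
  time.\<close>

theorem mainTheorem6:
  "\<exists>P :: com. \<forall>c :: nat. \<exists>C :: nat.
     \<forall>(n :: nat) (E :: nat set set) (N :: nat) (F :: nat set set) (r :: nat)
       (X :: nat \<Rightarrow> nat set) (w :: nat) (s :: state).
       simple_graph {..<n} E \<and>
       nice_tree_decomposition {..<n} E {..<N} F r X \<and>
       width {..<N} X = int w \<and>
       N \<le> c * n \<and>
       input_state n E N F r X s \<longrightarrow>
       (\<exists>k t. exec P s k t \<and>
          result t = int (num_perfect_matchings {..<n} E) \<and>
          k \<le> C * (3 ^ w * n) \<and>
          (no_join_nodes {..<N} F r \<and> 1 \<le> w \<longrightarrow> k \<le> C * (w * 2 ^ w * n)))"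
proof (rule exI[of _ main_prog], rule allI, rule exI, intro allI impI, elim conjE)
  fix c n N r w :: nat and E F :: "nat set set" and X and s
  assume graph: "simple_graph {..<n} E" and nice: "nice_tree_decomposition {..<n} E {..<N} F r X"
    and width: "width {..<N} X = int w" and N: "N \<le> c * n" and input: "input_state n E N F r X s"
  from input obtain adj chs bags where
    lists: "lists_represent n (\<lambda>v. {u. {v, u} \<in> E}) adj" "lists_represent N (children F r) chs"
      "lists_represent N X bags" and s: "s = initial_state adj r chs bags"
    unfolding input_state_def by blast
  interpret dp_input N n F r E X chs bags
  proof
    show "is_tree {..<N} F" "r \<in> {..<N}"
      using nice unfolding nice_tree_decomposition_def tree_decomposition_def by blast+
  qed (use graph nice lists in blast)+
  have bag: "card (X i) \<le> w + 1" if "i < N" for i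
  proof -
    have "card (X i) \<le> Max ((\<lambda>i. card (X i)) ` {..<N})" using that by (intro Max_ge) auto
    also have "\<dots> = w + 1" using width unfolding width_def by simp
    finally show ?thesis .
  qed
  define B where "B = Max (node_cost ` {..<N})"
  have "0 < N" using root by simp
  then have B_le: "B \<le> b" if "\<And>i. i < N \<Longrightarrow> node_cost i \<le> b" for b
    unfolding B_def using that by (subst Max_le_iff) auto
  have "node_cost i \<le> B" if "i < N" for i unfolding B_def using that by (intro Max_ge) auto
  from wp_main_prog[OF s lists(1) this] obtain k t where run: "exec main_prog s k t"
    "result t = int (num_perfect_matchings {..<n} E)"
    "k \<le> 300 * (n + length (concat adj) + N + 1) + N * (B + 40)"
    unfolding wp_def by blast
  have d: "length (concat adj) \<le> N * (w + 1)\<^sup>2" by (rule sum_degrees_le[OF lists(1) bag])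
  \<comment> \<open>The tree has a node, so \<open>c * n\<close> is positive; a positive
    \<open>n\<close> absorbs the additive constants.\<close>
  have n: "1 \<le> n" using N \<open>0 < N\<close> by (cases n) auto
  have unary: "(card (X i) + 1) * 2 ^ card (X i) \<le> (w + 2) * (2::nat) ^ (w + 1)" if "i < N" for i
    using bag[OF that] by (intro mult_le_mono power_increasing) simp_all
  \<comment> \<open>Joins cost at most \<open>500 * 3\<close> and all other nodes at most
    \<open>600 * 4\<close> times \<open>3 ^ w\<close>; 3600 is the value \<open>600 * 6\<close> that
    the path case requires, used for both.\<close>
  have B3: "B \<le> 3600 * 3 ^ w"
  proof (rule B_le)
    fix i assume i: "i < N"
    have "(3::nat) ^ card (X i) \<le> 3 ^ (w + 1)" using bag[OF i] by (intro power_increasing) simp_all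
    then show "node_cost i \<le> 3600 * 3 ^ w"
      using unary[OF i] mult_pow2_le_pow3[of w] unfolding node_cost_def by simp
  qed
  have "k \<le> (600 + 5140 * c) * (3 ^ w * n)"
    by (rule order_trans[OF run(3) total_time_le[OF d square_le_pow3 B3 N n]]) simp
  moreover have "k \<le> (600 + 5140 * c) * (w * 2 ^ w * n)" if "no_join_nodes {..<N} F r \<and> 1 \<le> w"
  proof -
    have w: "1 \<le> w" using that by simp
    have no_join: "card (ch i) \<noteq> 2" if "i < N" for i
      using \<open>no_join_nodes {..<N} F r \<and> 1 \<le> w\<close> that unfolding no_join_nodes_def by simp
    \<comment> \<open>\<open>1 \<le> w\<close> turns additive constants into multiples of
      \<open>w\<close>, here and for \<open>six\<close>; one factor of the square is then traded for
      \<open>2 ^ w\<close>.\<close>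
    have "w + 1 \<le> 2 * w" "w \<le> 2 ^ w" using w less_exp[of w] by simp_all
    then have "(w + 1)\<^sup>2 \<le> (2 * w) * (2 * 2 ^ w)" unfolding power2_eq_square
      by (intro mult_le_mono) linarith+
    then have square: "(w + 1)\<^sup>2 \<le> 4 * (w * 2 ^ w)" by simp
    have "(w + 2) * 2 ^ (w + 1) \<le> (3 * w) * (2::nat) ^ (w + 1)" using w by (intro mult_le_mono) simp_all
    then have six: "(w + 2) * 2 ^ (w + 1) \<le> 6 * (w * (2::nat) ^ w)" by simp
    have B2: "B \<le> 3600 * (w * 2 ^ w)"
    proof (rule B_le)
      fix i assume i: "i < N"
      have "node_cost i = 600 * ((card (X i) + 1) * 2 ^ card (X i))"
        using no_join[OF i] unfolding node_cost_def by simp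
      moreover have "(card (X i) + 1) * 2 ^ card (X i) \<le> 6 * (w * 2 ^ w)"
        using unary[OF i] six by (rule order_trans)
      ultimately show "node_cost i \<le> 3600 * (w * 2 ^ w)" by linarith
    qed
    show ?thesis
      by (rule order_trans[OF run(3) total_time_le[OF d square B2 N n]]) (use w in simp)
  qed
  ultimately show "\<exists>k t. exec main_prog s k t \<and>
      result t = int (num_perfect_matchings {..<n} E) \<and> k \<le> (600 + 5140 * c) * (3 ^ w * n) \<and>
      (no_join_nodes {..<N} F r \<and> 1 \<le> w \<longrightarrow> k \<le> (600 + 5140 * c) * (w * 2 ^ w * n))"
    using run by blast
qed

end
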